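(* Let $F$ be a field, let $(\mathcal K,g)$ be a finite filtered chain complex over $F$, let $\mathbb M$ be a vital filtered Morse construction and let $\mathbb M^\infty(\mathcal K)$ be the resulting iterated Morse complex. Then, in every dimension, the multiset of persistence intervals of $\mathcal K$ and the multiset of intervals output by the interval algorithm (described in the context) run on $\mathbb M^\infty(\mathcal K)$ are the same.
   Context: **Chain complexes.** A finite chain complex $\mathcal K$ over $F$ means a finite set of cells, each with a dimension $\dim A\in\mathbb Z_{\ge 0}$, with incidence indices $\kappa(A,b)\in F$ for cells with $\dim A=\dim b+1$ (and $\kappa(A,b)=0$ for all other pairs), such that $\partial A=\sum_b\kappa(A,b)\,b$, extended linearly to the free $F$-modules on $p$-cells, satisfies $\partial\partial=0$. If $\kappa(A,b)\ne 0$, $b$ is a face of $A$. It is filtered by $g:\mathcal K\to\mathbb Z$ if $g(b)\le g(A)$ whenever $b$ is a face of $A$; then $\mathcal K_t=\{A: g(A)\le t\}$ is a subcomplex for each $t\in\mathbb Z$. **Morse matchings and complexes.** A matching $M$ is a set of pairwise disjoint pairs $(A,b)$ with $\kappa(A,b)\neq0$; unmatched cells are critical. Its Morse graph is the directed graph on the cells with an edge $A\to b$ for each $\kappa(A,b)\ne0$ with $(A,b)\notin M$, and an edge $b\to A$ for each $(A,b)\in M$. $M$ is acyclic if this graph has no directed cycle. All matchings are assumed acyclic. $M$ is compatible with the filtration if $g(A)=g(b)$ for all $(A,b)\in M$. The Morse complex of $M$ has as cells the critical cells (same dimensions, same values of $g$), with incidence of critical $s$ and $c$, $\dim s=\dim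 c+1$, equal to the sum, over all directed paths $s=A_0\to a_1\to A_1\to a_2\to\dots\to a_k\to A_k\to c$ ($k\ge0$, $(A_i,a_i)\in M$ for $1\le i\le k$) in the Morse graph, of $(-1)^k\,\kappa(A_0,a_1)\prod_{i=1}^{k}\kappa(A_i,a_i)^{-1}\kappa(A_i,a_{i+1})$, where $a_{k+1}:=c$. (Over $\mathbb Z_2$: the number of such paths mod 2.) **Vital filtered Morse construction.** An assignment $\mathbb M$ sending each finite filtered chain complex to the Morse complex of some acyclic matching on it compatible with its filtration, such that (vitality) this matching is nonempty whenever there are cells $A,b$ with $\kappa(A,b)\neq0$ and $g(A)=g(b)$. Nothing else is assumed about $\mathbb M$. The sequence $\mathcal K,\mathbb M(\mathcal K),\mathbb M^2(\mathcal K),\dots$ stabilizes; the iterated Morse complex $\mathbb M^\infty(\mathcal K)$ is the stable value. **Persistence intervals.** For $i\le j$ let $\beta_p^{i,j}$ be the rank of the inclusion-induced map $H_p(\mathcal K_i)\to H_p(\mathcal K_j)$ (homology over $F$). The multiset of $p$-dimensional persistence intervals of $\mathcal K$ contains, for $i<j$, the interval $[i,j]$ with multiplicity $(\beta_p^{i,j-1}-\beta_p^{i-1,j-1})-(\beta_p^{i,j}-\beta_p^{i-1,j})$, and $[i,\infty]$ with multiplicity $\beta_p^{i,N}-\beta_p^{i-1,N}$, where $N$ is the maximum value of $g$. **The interval algorithm.** Input: $C=\mathbb M^\infty(\mathcal K)$. Initialize $S$ as the empty multiset of intervals (each with a dimension). Process the filtration values $i$ of $C$ in increasing order, from the second smallest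 to the largest. For each $i$, repeat the following on the current complex $C$: (1) Choose an acyclic matching $M$ on the current complex $C$, all of whose pairs $(A,b)$ consist of cells of $C_i=\{c\in C: g(c)\le i\}$. Pairs with $g(b)<g(A)$ are allowed. Each matched $A$ must be matched with a face of maximal filtration value, i.e. for each $(A,b)\in M$, $\kappa(A,b)\ne 0$ and $g(b')\le g(b)$ for every face $b'$ of $A$ in the current $C$. The choice is vital: $M\neq\emptyset$ whenever $\kappa(A,b)\ne0$ for some $A,b\in C_i$. Otherwise the choice is arbitrary. (2) If $M$ is empty, go to the next value of $i$. (3) For each $(A,b)\in M$ add the interval $[g(b),g(A)]$ in dimension $\dim b$ to $S$. (4) Replace $C$ by the Morse complex of $M$ on the whole current complex $C$ (cells keep their dimensions and $g$-values). After all values of $i$ are processed, for each remaining cell $c$ of $C$ add $[g(c),\infty]$ in dimension $\dim c$ to $S$. Output $S$. *)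

theory Defs
  imports
    "Jordan_Normal_Form.VS_Connect"
    "HOL-Algebra.AbelCoset"
    "HOL-Library.Extended"
    "HOL-Library.Multiset"
begin

section \<open>Filtered chain complexes\<close>

text \<open>The functions \<open>cdim\<close> and \<open>filt\<close> are only meaningful on \<open>cells\<close>.\<close>

record ('c, 'f) filtered_complex =
  cells :: "'c set"
  cdim :: "'c \<Rightarrow> nat"
  inc :: "'c \<Rightarrow> 'c \<Rightarrow> 'f"
  filt :: "'c \<Rightarrow> int"

text \<open>The free module on the \<open>p\<close>-cells consists of the functions supported on them.\<close>

definition chains :: "('c, 'f::field) filtered_complex \<Rightarrow> nat \<Rightarrow> ('c \<Rightarrow> 'f) set" where
  "chains K p = {x. \<forall>c. x c \<noteq> 0 \<longrightarrow> c \<in> cells K \<and> cdim K c = p}"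

definition boundary :: "('c, 'f::field) filtered_complex \<Rightarrow> ('c \<Rightarrow> 'f) \<Rightarrow> ('c \<Rightarrow> 'f)" where
  "boundary K x = (\<lambda>b. \<Sum>A\<in>cells K. x A * inc K A b)"

definition face :: "('c, 'f::field) filtered_complex \<Rightarrow> 'c \<Rightarrow> 'c \<Rightarrow> bool" where
  "face K b A \<longleftrightarrow> inc K A b \<noteq> 0"

definition finite_filtered_chain_complex :: "('c, 'f::field) filtered_complex \<Rightarrow> bool" where
  "finite_filtered_chain_complex K \<longleftrightarrow>
     finite (cells K) \<and>
     (\<forall>A b. inc K A b \<noteq> 0 \<longrightarrow> A \<in> cells K \<and> b \<in> cells K \<and> cdim K A = cdim K b + 1) \<and>
     (\<forall>p. \<forall>x\<in>chains K p. boundary K (boundary K x) = (\<lambda>_. 0)) \<and>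
     (\<forall>A b. face K b A \<longrightarrow> filt K b \<le> filt K A)"

definition sublevel :: "('c, 'f::field) filtered_complex \<Rightarrow> int \<Rightarrow> ('c, 'f) filtered_complex" where
  "sublevel K t = K\<lparr>cells := {A \<in> cells K. filt K A \<le> t},
     inc := \<lambda>A b. if A \<in> cells K \<and> filt K A \<le> t \<and> b \<in> cells K \<and> filt K b \<le> t
                  then inc K A b else 0\<rparr>"


section \<open>Morse matchings and Morse complexes\<close>

text \<open>A pair \<open>(A, b)\<close> of a matching consists of the higher-dimensional cell \<open>A\<close> and its face \<open>b\<close>.\<close>

definition matching :: "('c, 'f::field) filtered_complex \<Rightarrow> ('c \<times> 'c) set \<Rightarrow> bool" where
  "matching K M \<longleftrightarrow>
     (\<forall>(A, b)\<in>M. A \<in> cells K \<and> b \<in> cells K \<and> inc K A b \<noteq> 0) \<and>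
     (\<forall>(A, b)\<in>M. \<forall>(A', b')\<in>M. (A, b) \<noteq> (A', b') \<longrightarrow> {A, b} \<inter> {A', b'} = {})"

definition critical :: "('c, 'f::field) filtered_complex \<Rightarrow> ('c \<times> 'c) set \<Rightarrow> 'c set" where
  "critical K M = {c \<in> cells K. \<forall>(A, b)\<in>M. c \<noteq> A \<and> c \<noteq> b}"

definition morse_graph :: "('c, 'f::field) filtered_complex \<Rightarrow> ('c \<times> 'c) set \<Rightarrow> ('c \<times> 'c) set" where
  "morse_graph K M =
     {(A, b). A \<in> cells K \<and> b \<in> cells K \<and> inc K A b \<noteq> 0 \<and> (A, b) \<notin> M} \<union> {(b, A). (A, b) \<in> M}"

definition acyclic_matching :: "('c, 'f::field) filtered_complex \<Rightarrow> ('c \<times> 'c) set \<Rightarrow> bool" where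
  "acyclic_matching K M \<longleftrightarrow> matching K M \<and> acyclic (morse_graph K M)"

definition compatible :: "('c, 'f::field) filtered_complex \<Rightarrow> ('c \<times> 'c) set \<Rightarrow> bool" where
  "compatible K M \<longleftrightarrow> (\<forall>(A, b)\<in>M. filt K A = filt K b)"

text \<open>
  A path \<open>s = A\<^sub>0 \<rightarrow> a\<^sub>1 \<rightarrow> A\<^sub>1 \<rightarrow> a\<^sub>2 \<rightarrow> \<dots> \<rightarrow> a\<^sub>k \<rightarrow> A\<^sub>k \<rightarrow> a\<^bsub>k+1\<^esub> = c\<close> is encoded by the list
  \<open>[(A\<^sub>1, a\<^sub>1), \<dots>, (A\<^sub>k, a\<^sub>k)]\<close> of matched pairs it traverses. \<open>uppers\<close> lists
  \<open>A\<^sub>0, \<dots>, A\<^sub>k\<close> and \<open>lowers\<close> lists \<open>a\<^sub>1, \<dots>, a\<^bsub>k+1\<^esub>\<close>, so that \<open>lowers ps c ! i\<close> is \<open>a\<^bsub>i+1\<^esub>\<close>.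
\<close>

definition uppers :: "'c \<Rightarrow> ('c \<times> 'c) list \<Rightarrow> 'c list" where
  "uppers s ps = s # map fst ps"

definition lowers :: "('c \<times> 'c) list \<Rightarrow> 'c \<Rightarrow> 'c list" where
  "lowers ps c = map snd ps @ [c]"

definition morse_paths ::
  "('c, 'f::field) filtered_complex \<Rightarrow> ('c \<times> 'c) set \<Rightarrow> 'c \<Rightarrow> 'c \<Rightarrow> ('c \<times> 'c) list set" where
  "morse_paths K M s c = {ps. set ps \<subseteq> M \<and>
     (\<forall>i\<le>length ps. (uppers s ps ! i, lowers ps c ! i) \<in> morse_graph K M) \<and>
     (\<forall>i<length ps. (lowers ps c ! i, uppers s ps ! Suc i) \<in> morse_graph K M)}"

definition path_weight ::
  "('c, 'f::field) filtered_complex \<Rightarrow> 'c \<Rightarrow> ('c \<times> 'c) list \<Rightarrow> 'c \<Rightarrow> 'f" where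
  "path_weight K s ps c =
     (- 1) ^ length ps * inc K (uppers s ps ! 0) (lowers ps c ! 0) *
     (\<Prod>i = 1..length ps.
        inverse (inc K (uppers s ps ! i) (lowers ps c ! (i - 1))) *
        inc K (uppers s ps ! i) (lowers ps c ! i))"

definition morse_complex ::
  "('c, 'f::field) filtered_complex \<Rightarrow> ('c \<times> 'c) set \<Rightarrow> ('c, 'f) filtered_complex" where
  "morse_complex K M = K\<lparr>cells := critical K M,
     inc := \<lambda>s c. if s \<in> critical K M \<and> c \<in> critical K M \<and> cdim K s = cdim K c + 1
                  then \<Sum>ps\<in>morse_paths K M s c. path_weight K s ps c else 0\<rparr>"

definition vital_filtered_morse_construction ::
  "(('c, 'f::field) filtered_complex \<Rightarrow> ('c, 'f) filtered_complex) \<Rightarrow> bool" where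
  "vital_filtered_morse_construction MM \<longleftrightarrow>
     (\<forall>K. finite_filtered_chain_complex K \<longrightarrow>
       (\<exists>M. acyclic_matching K M \<and> compatible K M \<and>
            ((\<exists>A\<in>cells K. \<exists>b\<in>cells K. inc K A b \<noteq> 0 \<and> filt K A = filt K b) \<longrightarrow> M \<noteq> {}) \<and>
            MM K = morse_complex K M))"

definition iterated_morse_complex ::
  "(('c, 'f::field) filtered_complex \<Rightarrow> ('c, 'f) filtered_complex) \<Rightarrow>
   ('c, 'f) filtered_complex \<Rightarrow> ('c, 'f) filtered_complex" where
  "iterated_morse_complex MM K = (THE L. \<exists>n. \<forall>m\<ge>n. (MM ^^ m) K = L)"


section \<open>Persistent homology\<close>

text \<open>The \<open>mult\<close> and \<open>one\<close> fields of a module record play no role and are left unspecified.\<close>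

definition quotient_space ::
  "('f, 'v) module \<Rightarrow> 'v set \<Rightarrow> ('f, 'v set) module" where
  "quotient_space V W = \<lparr>carrier = a_rcosets\<^bsub>V\<^esub> W, mult = undefined, one = undefined,
     zero = W, add = set_add V, smult = \<lambda>a X. \<Union>x\<in>X. W +>\<^bsub>V\<^esub> (a \<odot>\<^bsub>V\<^esub> x)\<rparr>"

definition cycle_space :: "('c, 'f::field) filtered_complex \<Rightarrow> nat \<Rightarrow> ('f, 'c \<Rightarrow> 'f) module" where
  "cycle_space K p = \<lparr>carrier = {x \<in> chains K p. boundary K x = (\<lambda>_. 0)},
     mult = undefined, one = undefined,
     zero = \<lambda>_. 0, add = \<lambda>x y c. x c + y c, smult = \<lambda>a x c. a * x c\<rparr>"

definition boundaries :: "('c, 'f::field) filtered_complex \<Rightarrow> nat \<Rightarrow> ('c \<Rightarrow> 'f) set" where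
  "boundaries K p = boundary K ` chains K (p + 1)"

definition homology :: "('c, 'f::field) filtered_complex \<Rightarrow> nat \<Rightarrow> ('f, ('c \<Rightarrow> 'f) set) module" where
  "homology K p = quotient_space (cycle_space K p) (boundaries K p)"

text \<open>The map \<open>H\<^sub>p(L) \<rightarrow> H\<^sub>p(L')\<close>, \<open>[x] \<mapsto> [x]\<close>, induced by the inclusion of a subcomplex \<open>L\<close> of \<open>L'\<close>.\<close>

definition inclusion_map ::
  "('c, 'f::field) filtered_complex \<Rightarrow> nat \<Rightarrow> ('c \<Rightarrow> 'f) set \<Rightarrow> ('c \<Rightarrow> 'f) set" where
  "inclusion_map L' p X = (\<Union>x\<in>X. boundaries L' p +>\<^bsub>cycle_space L' p\<^esub> x)"

definition persistent_betti :: "('c, 'f::field) filtered_complex \<Rightarrow> nat \<Rightarrow> int \<Rightarrow> int \<Rightarrow> nat" where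
  "persistent_betti K p i j =
     vectorspace.dim class_ring
       ((homology (sublevel K j) p)
          \<lparr>carrier := inclusion_map (sublevel K j) p ` carrier (homology (sublevel K i) p)\<rparr>)"

text \<open>The interval \<open>[i, j]\<close> is the pair \<open>(i, Fin j)\<close>, and \<open>[i, \<infinity>]\<close> is \<open>(i, Pinf)\<close>.\<close>

type_synonym interval = "int \<times> int extended"

definition interval_multiplicity ::
  "('c, 'f::field) filtered_complex \<Rightarrow> nat \<Rightarrow> interval \<Rightarrow> int" where
  "interval_multiplicity K p I =
     (let \<beta> = (\<lambda>i j. int (persistent_betti K p i j)); N = Max (filt K ` cells K); i = fst I in
      case snd I of
        Fin j \<Rightarrow> if i < j then (\<beta> i (j - 1) - \<beta> (i - 1) (j - 1)) - (\<beta> i j - \<beta> (i - 1) j) else 0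
      | Pinf \<Rightarrow> if i \<le> N then \<beta> i N - \<beta> (i - 1) N else 0
      | Minf \<Rightarrow> 0)"

text \<open>
  The multiplicities are differences, so the multiset is described by its integer-valued counts
  instead of by truncation to natural numbers: it is well-defined only if they are nonnegative and
  almost all zero.
\<close>

definition persistence_intervals ::
  "('c, 'f::field) filtered_complex \<Rightarrow> nat \<Rightarrow> interval multiset" where
  "persistence_intervals K p = (THE D. \<forall>I. int (count D I) = interval_multiplicity K p I)"


section \<open>The interval algorithm\<close>

definition admissible_choice ::
  "('c, 'f::field) filtered_complex \<Rightarrow> int \<Rightarrow> ('c \<times> 'c) set \<Rightarrow> bool" where
  "admissible_choice C i M \<longleftrightarrow>
     acyclic_matching C M \<and>
     (\<forall>(A, b)\<in>M. filt C A \<le> i \<and> filt C b \<le> i) \<and>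
     (\<forall>(A, b)\<in>M. \<forall>b'. face C b' A \<longrightarrow> filt C b' \<le> filt C b) \<and>
     ((\<exists>A\<in>cells C. \<exists>b\<in>cells C. filt C A \<le> i \<and> filt C b \<le> i \<and> inc C A b \<noteq> 0) \<longrightarrow> M \<noteq> {})"

text \<open>The collected intervals carry their dimension as first component.\<close>

definition matched_intervals ::
  "('c, 'f::field) filtered_complex \<Rightarrow> ('c \<times> 'c) set \<Rightarrow> (nat \<times> interval) multiset" where
  "matched_intervals C M =
     image_mset (\<lambda>(A, b). (cdim C b, (filt C b, Fin (filt C A)))) (mset_set M)"

definition remaining_intervals ::
  "('c, 'f::field) filtered_complex \<Rightarrow> (nat \<times> interval) multiset" where
  "remaining_intervals C = image_mset (\<lambda>c. (cdim C c, (filt C c, Pinf))) (mset_set (cells C))"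

text \<open>
  The choices of matchings are arbitrary, so the algorithm is a relation between states. A state
  consists of the current complex and the intervals collected so far.
\<close>

inductive process_level ::
  "int \<Rightarrow> ('c, 'f::field) filtered_complex \<times> (nat \<times> interval) multiset \<Rightarrow>
   ('c, 'f) filtered_complex \<times> (nat \<times> interval) multiset \<Rightarrow> bool" for i :: int where
  finish: "admissible_choice C i {} \<Longrightarrow> process_level i (C, S) (C, S)"
| continue: "\<lbrakk>admissible_choice C i M; M \<noteq> {};
      process_level i (morse_complex C M, S + matched_intervals C M) T\<rbrakk>
    \<Longrightarrow> process_level i (C, S) T"

inductive process_levels ::
  "int list \<Rightarrow> ('c, 'f::field) filtered_complex \<times> (nat \<times> interval) multiset \<Rightarrow>
   ('c, 'f) filtered_complex \<times> (nat \<times> interval) multiset \<Rightarrow> bool" where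
  Nil: "process_levels [] T T"
| Cons: "\<lbrakk>process_level i T T'; process_levels ls T' T''\<rbrakk> \<Longrightarrow> process_levels (i # ls) T T''"

definition interval_algorithm ::
  "('c, 'f::field) filtered_complex \<Rightarrow> (nat \<times> interval) multiset \<Rightarrow> bool" where
  "interval_algorithm C out \<longleftrightarrow>
     (\<exists>C' S. process_levels (tl (sorted_list_of_set (filt C ` cells C))) (C, {#}) (C', S) \<and>
             out = S + remaining_intervals C')"

definition intervals_of_dim :: "nat \<Rightarrow> (nat \<times> interval) multiset \<Rightarrow> interval multiset" where
  "intervals_of_dim p S = image_mset snd (filter_mset (\<lambda>x. fst x = p) S)"

end

theory Submission
  imports Defs
begin

text \<open>
  Call an acyclic matching shallow if in each pair \<open>(A, b)\<close> the cell \<open>b\<close> is a face of \<open>A\<close> of maximal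
  filtration value and \<open>A\<close> is a coface of \<open>b\<close> of minimal filtration value. Matchings compatible with
  the filtration are shallow; those of the interval algorithm are shallow because, when the value
  \<open>i\<close> is processed, no cell of smaller value has a face left. For a shallow matching the complex
  splits, as a filtered complex, into a copy of its Morse complex and one summand \<open>A \<rightarrow> \<partial>A\<close>, with
  values \<open>g(A)\<close> and \<open>g(b)\<close>, for every pair. Reading the run of the algorithm backwards, starting
  from a complex without incidences, therefore gives \<open>K\<close> a filtered basis in which the boundary
  maps each basis element to another one or to zero, and every basis element to which another one
  is mapped has zero boundary. The persistence intervals can be read off such a basis.
\<close>

section \<open>Linear combinations of functions\<close>

text \<open>A matching of the algorithm may pair cells of different values, so its Morse complex
  need not have the homology of \<open>K\<close> on each sublevel; the induction has to record what
  is lost. The two halves of shallowness play dual roles here. The minimal coface condition keeps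
  the correction terms of a critical cell within the sublevel of that cell, so the Morse complex
  embeds into \<open>K\<close> as a filtered complex. The maximal face condition keeps all of the
  boundary of \<open>A\<close> at the value of \<open>b\<close>, so a pair contributes a summand
  whose bar runs exactly from g(b) to g(A). Strict decrease of values along incidences, reached by
  the iterated Morse complex and inherited by Morse complexes of shallow matchings, excludes bars of
  length zero from the output. Explicit bases avoid any comparison of homology between different
  complexes: ranks are computed once, in a basis where cycles and boundaries of every sublevel
  become coordinate subspaces. As the algorithm is a relation, a run must also be shown to
  exist.\<close>

definition lin_comb :: "'a set \<Rightarrow> ('a \<Rightarrow> 'c \<Rightarrow> 'f::field) \<Rightarrow> ('a \<Rightarrow> 'f) \<Rightarrow> 'c \<Rightarrow> 'f" where
  "lin_comb B e \<alpha> = (\<lambda>x. \<Sum>c\<in>B. \<alpha> c * e c x)"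

definition delta :: "'c \<Rightarrow> 'c \<Rightarrow> 'f::field" where
  "delta c = (\<lambda>x. if x = c then 1 else 0)"

lemma boundary_lin_comb: "boundary K = lin_comb (cells K) (inc K)"
  by (simp add: boundary_def lin_comb_def fun_eq_iff)

text \<open>Composition of linear maps as a matrix product. The boundary, the embedding
  \<open>Lift\<close> and every change of basis below are maps of the form
  \<open>lin_comb B e\<close>, so this lemma serves all of them.\<close>

lemma lin_comb_lin_comb:
  "lin_comb B e (lin_comb B' e' \<alpha>) = lin_comb B' (\<lambda>c. lin_comb B e (e' c)) \<alpha>"
  unfolding lin_comb_def sum_distrib_left sum_distrib_right
  by (subst sum.swap) (simp add: mult.assoc)

lemma boundary_lin_comb_commute:
  "boundary K (lin_comb B e \<alpha>) = lin_comb B (\<lambda>c. boundary K (e c)) \<alpha>"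
  by (simp add: boundary_lin_comb lin_comb_lin_comb)

lemma lin_comb_add:
  "lin_comb B e (\<lambda>c. \<alpha> c + \<beta> c) = (\<lambda>x. lin_comb B e \<alpha> x + lin_comb B e \<beta> x)"
  by (simp add: lin_comb_def sum.distrib algebra_simps)

lemma lin_comb_diff:
  "lin_comb B e (\<lambda>c. \<alpha> c - \<beta> c) = (\<lambda>x. lin_comb B e \<alpha> x - lin_comb B e \<beta> x)"
  by (simp add: lin_comb_def sum_subtractf algebra_simps)

lemma lin_comb_scale: "lin_comb B e (\<lambda>c. a * \<alpha> c) = (\<lambda>x. a * lin_comb B e \<alpha> x)"
  by (simp add: lin_comb_def sum_distrib_left mult.assoc)

lemma lin_comb_zero [simp]: "lin_comb B e (\<lambda>_. 0) = (\<lambda>_. 0)"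
  by (simp add: lin_comb_def)

lemma lin_comb_zero_vectors [simp]: "lin_comb B (\<lambda>_ _. 0) \<alpha> = (\<lambda>_. 0)"
  by (simp add: lin_comb_def)

lemma lin_comb_cong:
  "(\<And>c. c \<in> B \<Longrightarrow> \<alpha> c \<noteq> 0 \<Longrightarrow> e c = e' c) \<Longrightarrow> lin_comb B e \<alpha> = lin_comb B e' \<alpha>"
  unfolding lin_comb_def by (intro ext sum.cong) fastforce+

lemma lin_comb_coeff_cong:
  "(\<And>c. c \<in> B \<Longrightarrow> \<alpha> c = \<beta> c) \<Longrightarrow> lin_comb B e \<alpha> = lin_comb B e \<beta>"
  unfolding lin_comb_def by (intro ext sum.cong) auto

lemma lin_comb_mono_neutral:
  assumes "finite B'" "B \<subseteq> B'" "\<And>c. c \<in> B' - B \<Longrightarrow> \<alpha> c = 0"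
  shows "lin_comb B e \<alpha> = lin_comb B' e \<alpha>"
  unfolding lin_comb_def using assms by (intro ext sum.mono_neutral_left) auto

lemma lin_comb_delta:
  assumes "finite B" "c \<in> B"
  shows "lin_comb B e (delta c) = e c"
proof
  fix x
  have "lin_comb B e (delta c) x = (\<Sum>c'\<in>B. if c' = c then e c' x else 0)"
    unfolding lin_comb_def delta_def by (intro sum.cong) auto
  then show "lin_comb B e (delta c) x = e c x"
    using assms by simp
qed

lemma lin_comb_of_deltas:
  assumes "finite B" "\<And>c. x c \<noteq> 0 \<Longrightarrow> c \<in> B"
  shows "lin_comb B delta x = x"
proof
  fix y
  have "lin_comb B delta x y = (\<Sum>c\<in>B. if c = y then x c else 0)"
    unfolding lin_comb_def delta_def by (intro sum.cong) auto
  then show "lin_comb B delta x y = x y"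
    using assms by auto
qed

lemma lin_comb_nonzeroE:
  assumes "lin_comb B e \<alpha> x \<noteq> 0"
  obtains c where "c \<in> B" "\<alpha> c \<noteq> 0" "e c x \<noteq> 0"
proof -
  from assms have "(\<Sum>c\<in>B. \<alpha> c * e c x) \<noteq> 0"
    by (simp add: lin_comb_def)
  then obtain c where "c \<in> B" "\<alpha> c * e c x \<noteq> 0"
    by (rule sum.not_neutral_contains_not_neutral)
  then show thesis
    by (intro that[of c]) auto
qed

section \<open>Chain complexes\<close>

lemma fcc_finite: "finite_filtered_chain_complex K \<Longrightarrow> finite (cells K)"
  by (simp add: finite_filtered_chain_complex_def)

lemma fcc_incD:
  assumes "finite_filtered_chain_complex K" "inc K A b \<noteq> 0"
  shows "A \<in> cells K" "b \<in> cells K" "cdim K A = Suc (cdim K b)" "filt K b \<le> filt K A"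
  using assms by (auto simp: finite_filtered_chain_complex_def face_def)

lemma boundary_delta:
  assumes "finite_filtered_chain_complex K" "A \<in> cells K"
  shows "boundary K (delta A) = inc K A"
  using assms by (simp add: boundary_lin_comb lin_comb_delta fcc_finite)

lemma boundary_boundary:
  assumes K: "finite_filtered_chain_complex K"
  shows "boundary K (boundary K x) = (\<lambda>_. 0)"
proof -
  have "boundary K (inc K A) = (\<lambda>_. 0)" if "A \<in> cells K" for A
  proof -
    have "delta A \<in> chains K (cdim K A)"
      using that by (simp add: chains_def delta_def)
    then show ?thesis
      using K boundary_delta[OF K that] unfolding finite_filtered_chain_complex_def by metis
  qed
  then have "lin_comb (cells K) (\<lambda>A. boundary K (inc K A)) x = lin_comb (cells K) (\<lambda>_ _. 0) x"
    by (intro lin_comb_cong) auto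
  then show ?thesis
    by (simp add: boundary_lin_comb lin_comb_lin_comb)
qed

lemma boundary_support:
  assumes "finite_filtered_chain_complex K" "boundary K x b \<noteq> 0"
  shows "b \<in> cells K"
  using assms fcc_incD by (metis boundary_lin_comb lin_comb_nonzeroE)

section \<open>Shallow matchings\<close>

locale shallow_matching =
  fixes K :: "('c, 'f::field) filtered_complex" and M :: "('c \<times> 'c) set"
  assumes complex: "finite_filtered_chain_complex K"
    and acyclic_M: "acyclic_matching K M"
    and max_face: "\<And>A b b'. (A, b) \<in> M \<Longrightarrow> inc K A b' \<noteq> 0 \<Longrightarrow> filt K b' \<le> filt K b"
    and min_coface: "\<And>A b A'. (A, b) \<in> M \<Longrightarrow> inc K A' b \<noteq> 0 \<Longrightarrow> filt K A \<le> filt K A'"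
begin

abbreviation "C \<equiv> critical K M"
abbreviation "G \<equiv> morse_graph K M"
definition U :: "'c set" where
  "U = fst ` M"

definition lower :: "'c \<Rightarrow> 'c" where
  "lower A = (THE a. (A, a) \<in> M)"

lemmas incD = fcc_incD[OF complex]
lemmas finite_cells = fcc_finite[OF complex]

lemma matching: "matching K M"
  using acyclic_M by (simp add: acyclic_matching_def)

lemma M_D: "(A, a) \<in> M \<Longrightarrow> A \<in> cells K \<and> a \<in> cells K \<and> inc K A a \<noteq> 0"
  using matching unfolding matching_def by blast

lemma M_disjoint:
  "(A, a) \<in> M \<Longrightarrow> (A', a') \<in> M \<Longrightarrow> {A, a} \<inter> {A', a'} \<noteq> {} \<Longrightarrow> A = A' \<and> a = a'"
  using matching unfolding matching_def by blast

lemma lower_eq: "(A, a) \<in> M \<Longrightarrow> lower A = a"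
  unfolding lower_def using M_disjoint by blast

lemma M_iff: "(A, a) \<in> M \<longleftrightarrow> A \<in> U \<and> a = lower A"
  using lower_eq by (force simp: U_def)

lemma lower_in_M: "A \<in> U \<Longrightarrow> (A, lower A) \<in> M"
  by (simp add: M_iff)

lemma inc_lower: "A \<in> U \<Longrightarrow> inc K A (lower A) \<noteq> 0"
  using M_D lower_in_M by blast

lemma U_cells: "A \<in> U \<Longrightarrow> A \<in> cells K"
  using M_D lower_in_M by blast

lemma lower_cells: "A \<in> U \<Longrightarrow> lower A \<in> cells K"
  using M_D lower_in_M by blast

lemma lower_inj: "A \<in> U \<Longrightarrow> A' \<in> U \<Longrightarrow> lower A = lower A' \<Longrightarrow> A = A'"
  using M_disjoint[OF lower_in_M lower_in_M] by blast

lemma lower_neq_upper: "A \<in> U \<Longrightarrow> A' \<in> U \<Longrightarrow> lower A \<noteq> A'"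
proof
  assume A: "A \<in> U" "A' \<in> U" "lower A = A'"
  then have "A = A'"
    using M_disjoint[OF lower_in_M lower_in_M, of A A'] by simp
  then show False
    using incD(3)[OF inc_lower, of A] A by simp
qed

lemma critical_iff: "c \<in> C \<longleftrightarrow> c \<in> cells K \<and> c \<notin> U \<and> c \<notin> lower ` U"
proof -
  have "(\<forall>(A, b)\<in>M. c \<noteq> A \<and> c \<noteq> b) \<longleftrightarrow> c \<notin> U \<and> c \<notin> snd ` M"
    by (force simp: U_def)
  moreover have "snd ` M = lower ` U"
    using lower_eq by (force simp: U_def)
  ultimately show ?thesis
    by (simp add: critical_def)
qed

lemma finite_U: "finite U"
  by (rule finite_subset[OF _ finite_cells]) (rule subsetI, rule U_cells)

lemma finite_C: "finite C"
  using finite_cells by (simp add: critical_def)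

lemma G_up: "A \<in> U \<Longrightarrow> (lower A, A) \<in> G"
  using lower_in_M unfolding morse_graph_def by blast

lemma G_from_upper: "A \<in> U \<Longrightarrow> (A, c) \<in> G \<longleftrightarrow> inc K A c \<noteq> 0 \<and> c \<noteq> lower A"
  using incD[of A c] lower_neq_upper unfolding morse_graph_def by (auto simp: M_iff)

lemma G_from_critical: "s \<in> C \<Longrightarrow> (s, c) \<in> G \<longleftrightarrow> inc K s c \<noteq> 0"
  using incD[of s c] unfolding morse_graph_def by (auto simp: M_iff critical_iff)

lemma G_cells: "G \<subseteq> cells K \<times> cells K"
  using M_D unfolding morse_graph_def by auto

text \<open>Both directions are used: path sums and the triangular system for upper cells are
  treated by induction over predecessors, the spanning property of the extended basis by induction
  over successors.\<close>

lemma wf_G: "wf G" and wf_G_converse: "wf (G\<inverse>)"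
proof -
  have "finite G"
    using G_cells finite_cells finite_subset by blast
  then show "wf G" "wf (G\<inverse>)"
    using acyclic_M finite_acyclic_wf finite_acyclic_wf_converse
    unfolding acyclic_matching_def by blast+
qed

lemma inc_lower_upperD:
  assumes "A \<in> U" "A' \<in> U" "inc K A' (lower A) \<noteq> 0" "A' \<noteq> A"
  shows "(A', lower A) \<in> G"
  using assms G_from_upper lower_inj by metis

section \<open>Path sums\<close>

text \<open>The target is arbitrary because the recursion over the last pair of a path passes
  through lower cells, for which the sum is not a Morse incidence.\<close>

definition path_sum :: "'c \<Rightarrow> 'c \<Rightarrow> 'f" where
  "path_sum s c = (\<Sum>ps\<in>morse_paths K M s c. path_weight K s ps c)"

text \<open>The upward edges are the matched pairs themselves, so only the downward edges constrain
  a path.\<close>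

lemma morse_paths_eq:
  "morse_paths K M s c =
     {ps. set ps \<subseteq> M \<and> (\<forall>i\<le>length ps. (uppers s ps ! i, lowers ps c ! i) \<in> G)}"
proof -
  have "(lowers ps c ! i, uppers s ps ! Suc i) \<in> G" if "set ps \<subseteq> M" "i < length ps" for ps i
  proof -
    have "ps ! i \<in> M"
      using that by auto
    then have "(snd (ps ! i), fst (ps ! i)) \<in> G"
      unfolding morse_graph_def by auto
    then show ?thesis
      using that by (simp add: lowers_def uppers_def nth_append)
  qed
  then show ?thesis
    unfolding morse_paths_def by blast
qed

lemma uppers_snoc: "uppers s (ps @ [(A, a)]) = uppers s ps @ [A]"
  by (simp add: uppers_def)

lemma lowers_snoc: "lowers (ps @ [(A, a)]) c = lowers ps a @ [c]"
  by (simp add: lowers_def)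

lemma length_uppers_lowers: "length (uppers s ps) = Suc (length ps)" "length (lowers ps c) = Suc (length ps)"
  by (simp_all add: uppers_def lowers_def)

lemma Nil_in_morse_paths: "[] \<in> morse_paths K M s c \<longleftrightarrow> (s, c) \<in> G"
  by (simp add: morse_paths_eq uppers_def lowers_def)

lemma snoc_in_morse_paths:
  "ps @ [(A, a)] \<in> morse_paths K M s c \<longleftrightarrow>
     (A, a) \<in> M \<and> (A, c) \<in> G \<and> ps \<in> morse_paths K M s a"
  unfolding morse_paths_eq
  by (auto simp: uppers_snoc lowers_snoc le_Suc_eq nth_append length_uppers_lowers less_Suc_eq_le)

text \<open>Splitting at the end of the path, not at its start, keeps the source \<open>s\<close>
  fixed, as the coefficients of \<open>lift s\<close> require.\<close>

lemma morse_paths_step: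
  "morse_paths K M s c = (if (s, c) \<in> G then {[]} else {}) \<union>
     (\<Union>A\<in>{A\<in>U. (A, c) \<in> G}. (\<lambda>ps. ps @ [(A, lower A)]) ` morse_paths K M s (lower A))"
  (is "_ = ?R")
proof (rule Set.set_eqI)
  fix ps
  show "ps \<in> morse_paths K M s c \<longleftrightarrow> ps \<in> ?R"
  proof (cases ps rule: rev_cases)
    case Nil
    then show ?thesis
      by (auto simp: Nil_in_morse_paths)
  next
    case (snoc qs q)
    then show ?thesis
      by (cases q) (auto simp: snoc_in_morse_paths M_iff)
  qed
qed

text \<open>Removing a pair goes back two edges, from \<open>c\<close> to \<open>A\<close> to
  \<open>lower A\<close>, hence the transitive closure in the induction. Finiteness matters because
  a sum over an infinite set would be 0 by convention.\<close>

lemma finite_morse_paths: "finite (morse_paths K M s c)"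
proof (induction c rule: wf_induct_rule[OF wf_trancl[OF wf_G]])
  case (1 c)
  have "finite (morse_paths K M s (lower A))" if "A \<in> U" "(A, c) \<in> G" for A
    using 1 that G_up by (meson trancl.intros)
  then show ?case
    by (subst morse_paths_step) (simp add: finite_U)
qed

lemma path_weight_snoc:
  "path_weight K s (ps @ [(A, a)]) c =
     - (path_weight K s ps a * (inverse (inc K A a) * inc K A c))"
proof -
  have first: "uppers s (ps @ [(A, a)]) ! 0 = uppers s ps ! 0"
    "lowers (ps @ [(A, a)]) c ! 0 = lowers ps a ! 0"
    by (simp_all add: uppers_snoc lowers_snoc nth_append length_uppers_lowers)
  have last: "uppers s (ps @ [(A, a)]) ! Suc (length ps) = A"
    "lowers (ps @ [(A, a)]) c ! length ps = a"
    "lowers (ps @ [(A, a)]) c ! Suc (length ps) = c"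
    by (simp_all add: uppers_snoc lowers_snoc nth_append length_uppers_lowers)
      (simp add: lowers_def nth_append)
  have prod: "(\<Prod>i = 1..length ps.
        inverse (inc K (uppers s (ps @ [(A, a)]) ! i) (lowers (ps @ [(A, a)]) c ! (i - 1))) *
        inc K (uppers s (ps @ [(A, a)]) ! i) (lowers (ps @ [(A, a)]) c ! i)) =
      (\<Prod>i = 1..length ps.
        inverse (inc K (uppers s ps ! i) (lowers ps a ! (i - 1))) *
        inc K (uppers s ps ! i) (lowers ps a ! i))"
    by (intro prod.cong) (auto simp: uppers_snoc lowers_snoc nth_append length_uppers_lowers)
  show ?thesis
    unfolding path_weight_def by (simp add: first last prod[simplified] del: lowers_snoc)
qed

text \<open>Paths are sorted by their last pair. The path sums thus solve a linear system that is
  triangular along \<open>G\<close>; apart from the identification with Morse incidences, only this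
  recursion is used about them.\<close>

lemma path_sum_step:
  "path_sum s c = (if (s, c) \<in> G then inc K s c else 0) -
     (\<Sum>A\<in>{A\<in>U. (A, c) \<in> G}.
        path_sum s (lower A) * (inverse (inc K A (lower A)) * inc K A c))"
proof -
  let ?V = "{A\<in>U. (A, c) \<in> G}"
  let ?snoc = "\<lambda>A ps. ps @ [(A, lower A)]"
  have fin: "finite ?V"
    using finite_U by simp
  have "(\<Sum>ps\<in>(\<Union>A\<in>?V. ?snoc A ` morse_paths K M s (lower A)). path_weight K s ps c) =
      (\<Sum>A\<in>?V. \<Sum>ps\<in>?snoc A ` morse_paths K M s (lower A). path_weight K s ps c)"
    using fin by (intro sum.UNION_disjoint) (auto simp: finite_morse_paths)
  also have "\<dots> = (\<Sum>A\<in>?V. \<Sum>ps\<in>morse_paths K M s (lower A). path_weight K s (?snoc A ps) c)"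
    by (rule sum.cong[OF HOL.refl], subst sum.reindex) (auto simp: inj_on_def)
  also have "\<dots> = - (\<Sum>A\<in>?V. path_sum s (lower A) * (inverse (inc K A (lower A)) * inc K A c))"
    by (simp add: path_weight_snoc path_sum_def sum_negf sum_distrib_right)
  finally have rest: "(\<Sum>ps\<in>(\<Union>A\<in>?V. ?snoc A ` morse_paths K M s (lower A)). path_weight K s ps c) = \<dots>" .
  have "path_sum s c = (\<Sum>ps\<in>(if (s, c) \<in> G then {[]} else {}). path_weight K s ps c) +
      (\<Sum>ps\<in>(\<Union>A\<in>?V. ?snoc A ` morse_paths K M s (lower A)). path_weight K s ps c)"
    unfolding path_sum_def
    by (subst morse_paths_step, subst sum.union_disjoint) (auto simp: fin finite_morse_paths)
  then show ?thesis
    unfolding rest by (simp add: path_weight_def uppers_def lowers_def)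
qed

text \<open>By \<open>min_coface\<close>, climbing from a lower cell to its partner never exceeds
  the value of the coface just left, so no upper cell of the path exceeds \<open>s\<close>. The
  coface of \<open>c\<close> appears in the claim, in place of a bound on \<open>c\<close>, because
  the next climb is compared with it.\<close>

lemma path_sum_supportD:
  assumes s: "s \<in> C" and "path_sum s c \<noteq> 0"
  shows "cdim K s = Suc (cdim K c) \<and> (\<exists>b. inc K s b \<noteq> 0) \<and>
     (\<exists>A. inc K A c \<noteq> 0 \<and> filt K A \<le> filt K s)"
  using assms(2)
proof (induction c rule: wf_induct_rule[OF wf_trancl[OF wf_G]])
  case (1 c)
  show ?case
  proof (cases "inc K s c = 0")
    case False
    then show ?thesis
      using incD by auto
  next
    case True
    then have "(\<Sum>A\<in>{A\<in>U. (A, c) \<in> G}.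
        path_sum s (lower A) * (inverse (inc K A (lower A)) * inc K A c)) \<noteq> 0"
      using 1(2) path_sum_step[of s c] by (auto split: if_splits)
    then obtain A where A: "A \<in> U" "(A, c) \<in> G" "path_sum s (lower A) \<noteq> 0" "inc K A c \<noteq> 0"
      by (rule sum.not_neutral_contains_not_neutral) auto
    then obtain A' where "inc K A' (lower A) \<noteq> 0" "filt K A' \<le> filt K s"
      and "\<exists>b. inc K s b \<noteq> 0" "cdim K s = Suc (cdim K (lower A))"
      using 1(1)[of "lower A"] G_up by (meson trancl.intros)
    moreover from this(1) have "filt K A \<le> filt K A'"
      by (rule min_coface[OF lower_in_M[OF A(1)]])
    moreover have "cdim K A = Suc (cdim K (lower A))" "cdim K A = Suc (cdim K c)"
      using incD(3)[OF inc_lower[OF A(1)]] incD(3)[OF A(4)] by auto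
    ultimately show ?thesis
      using A(4) by auto
  qed
qed

section \<open>The Morse complex of a shallow matching\<close>

text \<open>
  \<open>lift s\<close> differs from \<open>s\<close> by upper cells of the matching only, with coefficients such that
  no lower cell is left in its boundary (\<open>boundary_lift_lower\<close>).
\<close>

definition lift :: "'c \<Rightarrow> 'c \<Rightarrow> 'f" where
  "lift s = (\<lambda>x. if x \<in> U then - (path_sum s (lower x) * inverse (inc K x (lower x))) else delta s x)"

abbreviation "Lift \<equiv> lin_comb C lift"

lemma lift_support:
  assumes s: "s \<in> C" and x: "lift s x \<noteq> 0"
  shows "x \<in> cells K" "cdim K x = cdim K s" "filt K x \<le> filt K s"
proof -
  have "x \<in> cells K \<and> cdim K x = cdim K s \<and> filt K x \<le> filt K s"
  proof (cases "x \<in> U")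
    case True
    then have "path_sum s (lower x) \<noteq> 0"
      using x by (auto simp: lift_def)
    from path_sum_supportD[OF s this]
    obtain A where "cdim K s = Suc (cdim K (lower x))" "inc K A (lower x) \<noteq> 0" "filt K A \<le> filt K s"
      by blast
    moreover from this(2) have "filt K x \<le> filt K A"
      by (rule min_coface[OF lower_in_M[OF True]])
    ultimately show ?thesis
      using U_cells[OF True] incD(3)[OF inc_lower[OF True]] by auto
  next
    case False
    then show ?thesis
      using x s by (auto simp: lift_def delta_def critical_iff split: if_splits)
  qed
  then show "x \<in> cells K" "cdim K x = cdim K s" "filt K x \<le> filt K s"
    by auto
qed

text \<open>Corrections live on upper cells only. Hence \<open>Lift\<close> can be inverted by
  reading off critical coordinates, and it vanishes on lower cells.\<close>

lemma Lift_not_upper: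
  assumes "x \<notin> U"
  shows "Lift y x = (if x \<in> C then y x else 0)"
proof -
  have "Lift y x = (\<Sum>s\<in>C. if s = x then y s else 0)"
    unfolding lin_comb_def using assms by (intro sum.cong) (auto simp: lift_def delta_def)
  then show ?thesis
    using finite_C by simp
qed

lemma boundary_lift:
  assumes s: "s \<in> C"
  shows "boundary K (lift s) b = inc K s b -
    (\<Sum>A\<in>U. path_sum s (lower A) * (inverse (inc K A (lower A)) * inc K A b))"
proof -
  have sub: "U \<subseteq> cells K"
    by (rule subsetI) (rule U_cells)
  have s': "s \<in> cells K - U"
    using s by (simp add: critical_iff)
  have "boundary K (lift s) b =
      (\<Sum>A\<in>cells K - U. lift s A * inc K A b) + (\<Sum>A\<in>U. lift s A * inc K A b)"
    unfolding boundary_def by (rule sum.subset_diff[OF sub finite_cells])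
  also have "(\<Sum>A\<in>cells K - U. lift s A * inc K A b) =
      (\<Sum>A\<in>cells K - U. if A = s then inc K A b else 0)"
    by (rule sum.cong) (auto simp: lift_def delta_def)
  also have "\<dots> = inc K s b"
    using s' finite_cells by simp
  also have "(\<Sum>A\<in>U. lift s A * inc K A b) =
      - (\<Sum>A\<in>U. path_sum s (lower A) * (inverse (inc K A (lower A)) * inc K A b))"
    unfolding sum_negf[symmetric] by (rule sum.cong) (auto simp: lift_def)
  finally show ?thesis
    by simp
qed

text \<open>A critical cell is nobody's partner, so each incidence from an upper cell to it is an
  edge of \<open>G\<close> and the correction terms are exactly those of
  \<open>path_sum_step\<close>.\<close>

lemma boundary_lift_critical:
  assumes s: "s \<in> C" and c: "c \<in> C"
  shows "boundary K (lift s) c = path_sum s c"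
proof -
  have "(\<Sum>A\<in>{A\<in>U. (A, c) \<in> G}. path_sum s (lower A) * (inverse (inc K A (lower A)) * inc K A c)) =
      (\<Sum>A\<in>U. path_sum s (lower A) * (inverse (inc K A (lower A)) * inc K A c))"
  proof (rule sum.mono_neutral_left)
    show "\<forall>A\<in>U - {A \<in> U. (A, c) \<in> G}.
        path_sum s (lower A) * (inverse (inc K A (lower A)) * inc K A c) = 0"
      using c G_from_upper[of _ c] by (auto simp: critical_iff)
  qed (use finite_U in auto)
  then show ?thesis
    using path_sum_step[of s c] G_from_critical[OF s, of c] boundary_lift[OF s, of c] by auto
qed

text \<open>Of the incidences from upper cells to \<open>lower A\<close>, only that of
  \<open>A\<close> itself is not an edge of \<open>G\<close>. Its term is
  \<open>path_sum s (lower A)\<close>, and it cancels the others by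
  \<open>path_sum_step\<close>.\<close>

lemma boundary_lift_lower:
  assumes s: "s \<in> C" and A: "A \<in> U"
  shows "boundary K (lift s) (lower A) = 0"
proof -
  let ?f = "\<lambda>B. path_sum s (lower B) * (inverse (inc K B (lower B)) * inc K B (lower A))"
  have "(\<Sum>B\<in>{B\<in>U. (B, lower A) \<in> G}. ?f B) = (\<Sum>B\<in>U - {A}. ?f B)"
  proof (rule sum.mono_neutral_left)
    show "{B \<in> U. (B, lower A) \<in> G} \<subseteq> U - {A}"
      using G_from_upper by auto
    show "\<forall>B\<in>U - {A} - {B \<in> U. (B, lower A) \<in> G}. ?f B = 0"
      using inc_lower_upperD[OF A] by auto
  qed (use finite_U in auto)
  moreover have "(\<Sum>B\<in>U. ?f B) = path_sum s (lower A) + (\<Sum>B\<in>U - {A}. ?f B)"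
    using sum.remove[OF finite_U A, of ?f] inc_lower[OF A] by simp
  ultimately show ?thesis
    using path_sum_step[of s "lower A"] G_from_critical[OF s, of "lower A"]
      boundary_lift[OF s, of "lower A"] by auto
qed

text \<open>The square matrix of incidences between upper and lower cells is triangular along
  \<open>G\<close> with nonzero diagonal, hence injective.\<close>

lemma zero_if_boundary_zero_on_lower:
  assumes supp: "\<And>c. x c \<noteq> 0 \<Longrightarrow> c \<in> U"
    and zero: "\<And>A. A \<in> U \<Longrightarrow> boundary K x (lower A) = 0"
  shows "x = (\<lambda>_. 0)"
proof
  fix A
  show "x A = 0"
  proof (induction A rule: wf_induct_rule[OF wf_trancl[OF wf_G]])
    case (1 A)
    show ?case
    proof (rule ccontr)
      assume "x A \<noteq> 0"
      then have A: "A \<in> U"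
        by (rule supp)
      have "boundary K x (lower A) = x A * inc K A (lower A) +
          (\<Sum>B\<in>cells K - {A}. x B * inc K B (lower A))"
        unfolding boundary_def by (rule sum.remove[OF finite_cells U_cells[OF A]])
      also have "(\<Sum>B\<in>cells K - {A}. x B * inc K B (lower A)) = 0"
      proof (rule sum.neutral, rule ballI, rule ccontr)
        fix B
        assume B: "B \<in> cells K - {A}" "x B * inc K B (lower A) \<noteq> 0"
        then have "B \<in> U" "inc K B (lower A) \<noteq> 0"
          using supp by auto
        then have "(B, lower A) \<in> G"
          using B inc_lower_upperD[OF A] by auto
        then have "x B = 0"
          using 1 G_up[OF A] by (meson trancl.intros)
        then show False
          using B by simp
      qed
      finally show False
        using zero[OF A] inc_lower[OF A] \<open>x A \<noteq> 0\<close> by simp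
    qed
  qed
qed

abbreviation "N \<equiv> morse_complex K M"

lemma N_simps [simp]: "cells N = C" "cdim N = cdim K" "filt N = filt K"
  by (simp_all add: morse_complex_def)

text \<open>The dimension test in \<open>morse_complex\<close> disappears since every nonzero path
  sum from a critical cell passes it.\<close>

lemma inc_N: "inc N s c = (if s \<in> C \<and> c \<in> C then path_sum s c else 0)"
  using path_sum_supportD[of s c] by (auto simp: morse_complex_def path_sum_def[symmetric])

lemma boundary_N: "c \<in> C \<Longrightarrow> boundary N y c = (\<Sum>s\<in>C. y s * path_sum s c)"
  unfolding boundary_def by (auto simp: inc_N intro: sum.cong)

lemma boundary_Lift_lower: "A \<in> U \<Longrightarrow> boundary K (Lift y) (lower A) = 0"
  unfolding boundary_lin_comb_commute unfolding lin_comb_def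
  by (simp add: boundary_lift_lower)

text \<open>\<open>Lift\<close> is a chain map. The difference \<open>z\<close> of the two sides
  vanishes on critical and lower cells, so it lives on upper cells; its boundary vanishes on lower
  cells, as the boundary squares to zero. Triangularity then forces \<open>z\<close> to vanish, and
  the coefficients on upper cells need not be computed.\<close>

lemma boundary_Lift: "boundary K (Lift y) = Lift (boundary N y)"
proof -
  define w where "w = boundary N y"
  define z where "z = (\<lambda>x. boundary K (Lift y) x - Lift w x)"
  have "z x = 0" if "x \<notin> U" for x
  proof -
    consider "x \<in> C" | A where "A \<in> U" "x = lower A" | "x \<notin> cells K"
      using \<open>x \<notin> U\<close> by (auto simp: critical_iff)
    then show ?thesis
    proof cases
      case 1
      have "boundary K (Lift y) x = (\<Sum>s\<in>C. y s * path_sum s x)"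
        unfolding boundary_lin_comb_commute unfolding lin_comb_def
        using 1 by (intro sum.cong) (auto simp: boundary_lift_critical)
      then show ?thesis
        using 1 that by (simp add: z_def w_def Lift_not_upper boundary_N)
    next
      case 2
      then show ?thesis
        using that by (auto simp: z_def Lift_not_upper boundary_Lift_lower critical_iff)
    next
      case 3
      then have "boundary K (Lift y) x = 0"
        using boundary_support[OF complex] by blast
      then show ?thesis
        using that 3 by (simp add: z_def Lift_not_upper critical_iff)
    qed
  qed
  moreover have "boundary K z (lower A) = 0" if "A \<in> U" for A
  proof -
    have "boundary K z = (\<lambda>x. boundary K (boundary K (Lift y)) x - boundary K (Lift w) x)"
      unfolding z_def unfolding boundary_lin_comb[of K] by (rule lin_comb_diff)
    then show ?thesis
      using that by (simp add: boundary_boundary[OF complex] boundary_Lift_lower)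
  qed
  ultimately have "z = (\<lambda>_. 0)"
    using zero_if_boundary_zero_on_lower by blast
  then show ?thesis
    by (simp add: z_def w_def fun_eq_iff)
qed

lemma inc_N_D:
  assumes "inc N s c \<noteq> 0"
  shows "s \<in> C" "c \<in> C" "cdim K s = Suc (cdim K c)" "\<exists>b. inc K s b \<noteq> 0"
    "\<exists>A. inc K A c \<noteq> 0 \<and> filt K A \<le> filt K s"
  using assms path_sum_supportD[of s c] by (auto simp: inc_N split: if_splits)

text \<open>That the boundary squares to zero is pulled back along the chain map
  \<open>Lift\<close>, whose critical coordinates determine its argument. Monotonicity of values
  comes from the last upper cell of a path, which does not exceed \<open>s\<close>.\<close>

lemma N_complex: "finite_filtered_chain_complex N"
  unfolding finite_filtered_chain_complex_def
proof (intro conjI allI impI ballI)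
  fix p y
  show "boundary N (boundary N y) = (\<lambda>_. 0)"
  proof
    fix c
    have "Lift (boundary N (boundary N y)) = (\<lambda>_. 0)"
      by (simp add: boundary_Lift[symmetric] boundary_boundary[OF complex])
    then have "Lift (boundary N (boundary N y)) c = 0"
      by simp
    moreover have "boundary N (boundary N y) c = 0" if "c \<notin> C"
      unfolding boundary_def using that by (simp add: inc_N)
    ultimately show "boundary N (boundary N y) c = 0"
      using Lift_not_upper[of c] critical_iff[of c] by (cases "c \<in> C") auto
  qed
next
  fix A b
  assume "face N b A"
  then show "filt N b \<le> filt N A"
    using inc_N_D(5)[of A b] incD(4) by (auto simp: face_def intro: order_trans)
qed (use finite_C inc_N_D in auto)

lemma N_strict:
  assumes "\<And>A b. inc K A b \<noteq> 0 \<Longrightarrow> filt K b < filt K A" "inc N s c \<noteq> 0"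
  shows "filt N c < filt N s"
  using assms(1) inc_N_D(5)[OF assms(2)] by force

end

section \<open>Filtered bases in normal form\<close>

definition fchains :: "('c, 'f::field) filtered_complex \<Rightarrow> nat \<Rightarrow> int \<Rightarrow> ('c \<Rightarrow> 'f) set" where
  "fchains K d t = {x. \<forall>c. x c \<noteq> 0 \<longrightarrow> c \<in> cells K \<and> cdim K c = d \<and> filt K c \<le> t}"

text \<open>A matching without incidence: pairs found in later Morse complexes need not be incident
  in \<open>K\<close>.\<close>

definition disjoint_pairs :: "('c \<times> 'c) set \<Rightarrow> bool" where
  "disjoint_pairs P \<longleftrightarrow>
     (\<forall>(A, b)\<in>P. \<forall>(A', b')\<in>P. (A, b) \<noteq> (A', b') \<longrightarrow> {A, b} \<inter> {A', b'} = {})"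

lemma disjoint_pairsD:
  assumes "disjoint_pairs P" "(A, b) \<in> P" "(A', b') \<in> P" "{A, b} \<inter> {A', b'} \<noteq> {}"
  shows "A = A' \<and> b = b'"
  using bspec[OF bspec[OF assms(1)[unfolded disjoint_pairs_def] assms(2), unfolded case_prod_conv]
      assms(3)] assms(4) by auto

text \<open>The Barannikov normal form. Cells serve as labels: \<open>e c\<close> has the dimension
  and value of \<open>c\<close> but may involve many cells. Support and spanning together say that
  the change of basis respects sublevels in both directions.\<close>

definition decomposition ::
  "('c, 'f::field) filtered_complex \<Rightarrow> ('c \<Rightarrow> 'c \<Rightarrow> 'f) \<Rightarrow> ('c \<times> 'c) set \<Rightarrow> bool" where
  "decomposition K e P \<longleftrightarrow>
     (\<forall>(A, b)\<in>P. A \<in> cells K \<and> b \<in> cells K \<and> cdim K A = Suc (cdim K b) \<and> filt K b \<le> filt K A) \<and>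
     disjoint_pairs P \<and>
     (\<forall>c\<in>cells K. e c \<in> fchains K (cdim K c) (filt K c)) \<and>
     (\<forall>\<alpha>. lin_comb (cells K) e \<alpha> = (\<lambda>_. 0) \<longrightarrow> (\<forall>c\<in>cells K. \<alpha> c = 0)) \<and>
     (\<forall>c\<in>cells K. delta c \<in> lin_comb (cells K) e ` fchains K (cdim K c) (filt K c)) \<and>
     (\<forall>(A, b)\<in>P. boundary K (e A) = e b) \<and>
     (\<forall>c\<in>cells K - fst ` P. boundary K (e c) = (\<lambda>_. 0))"

lemma fchains_mono: "s \<le> t \<Longrightarrow> fchains K d s \<subseteq> fchains K d t"
  unfolding fchains_def by force

lemma delta_in_fchains: "c \<in> cells K \<Longrightarrow> delta c \<in> fchains K (cdim K c) (filt K c)"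
  by (simp add: fchains_def delta_def)

lemma lin_comb_in_fchains:
  assumes "\<And>c. c \<in> B \<Longrightarrow> \<alpha> c \<noteq> 0 \<Longrightarrow> e c \<in> fchains K d t"
  shows "lin_comb B e \<alpha> \<in> fchains K d t"
  unfolding fchains_def
proof (intro CollectI allI impI)
  fix x
  assume "lin_comb B e \<alpha> x \<noteq> 0"
  then obtain c where "c \<in> B" "\<alpha> c \<noteq> 0" "e c x \<noteq> 0"
    by (rule lin_comb_nonzeroE)
  then show "x \<in> cells K \<and> cdim K x = d \<and> filt K x \<le> t"
    using assms[of c] by (auto simp: fchains_def)
qed

lemma lin_comb_in_image:
  assumes "\<And>c. c \<in> B \<Longrightarrow> \<alpha> c \<noteq> 0 \<Longrightarrow> e' c \<in> lin_comb (cells K) e ` fchains K d t"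
  shows "lin_comb B e' \<alpha> \<in> lin_comb (cells K) e ` fchains K d t"
proof -
  define \<beta> where "\<beta> c = (SOME x. x \<in> fchains K d t \<and> e' c = lin_comb (cells K) e x)" for c
  have \<beta>: "\<beta> c \<in> fchains K d t" "e' c = lin_comb (cells K) e (\<beta> c)" if "c \<in> B" "\<alpha> c \<noteq> 0" for c
    using assms[OF that] someI_ex[of "\<lambda>x. x \<in> fchains K d t \<and> e' c = lin_comb (cells K) e x"]
    unfolding \<beta>_def by blast+
  have "lin_comb B e' \<alpha> = lin_comb B (\<lambda>c. lin_comb (cells K) e (\<beta> c)) \<alpha>"
    by (rule lin_comb_cong) (rule \<beta>(2))
  also have "\<dots> = lin_comb (cells K) e (lin_comb B \<beta> \<alpha>)"
    by (simp add: lin_comb_lin_comb)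
  finally show ?thesis
    using lin_comb_in_fchains[of B \<alpha> \<beta> K d t] \<beta>(1) by blast
qed

lemma decomposition_no_incidence:
  assumes K: "finite_filtered_chain_complex K" and "\<And>A b. inc K A b = 0"
  shows "decomposition K delta {}"
proof -
  have id: "lin_comb (cells K) delta x = x" if "\<And>c. x c \<noteq> 0 \<Longrightarrow> c \<in> cells K" for x :: "'a \<Rightarrow> 'b"
    using fcc_finite[OF K] that by (rule lin_comb_of_deltas)
  have "\<alpha> c = 0" if "lin_comb (cells K) delta \<alpha> = (\<lambda>_. 0)" "c \<in> cells K" for \<alpha> :: "'a \<Rightarrow> 'b" and c
  proof -
    have "lin_comb (cells K) delta \<alpha> = lin_comb (cells K) delta (\<lambda>x. if x \<in> cells K then \<alpha> x else 0)"
      by (rule lin_comb_coeff_cong) simp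
    also have "\<dots> = (\<lambda>x. if x \<in> cells K then \<alpha> x else 0)"
      by (rule id) (simp split: if_splits)
    finally show ?thesis
      using that by (metis (no_types))
  qed
  moreover have "delta c \<in> lin_comb (cells K) delta ` fchains K (cdim K c) (filt K c)"
    if "c \<in> cells K" for c
    using id[of "delta c"] delta_in_fchains[OF that] that
    by (metis (no_types, lifting) delta_def image_eqI)
  ultimately show ?thesis
    using assms(2) by (auto simp: decomposition_def disjoint_pairs_def delta_in_fchains boundary_def)
qed

section \<open>Extending a normal-form basis from the Morse complex to the complex\<close>

context shallow_matching
begin

definition upper :: "'c \<Rightarrow> 'c" where
  "upper a = (THE A. (A, a) \<in> M)"

lemma upper_lower [simp]: "A \<in> U \<Longrightarrow> upper (lower A) = A"
  unfolding upper_def by (rule the_equality) (auto simp: M_iff dest: lower_inj)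

text \<open>The last branch concerns lower cells. Replacing \<open>lower A\<close> by the full
  boundary \<open>inc K A\<close> of its partner makes the boundary send a basis element to a basis
  element.\<close>

definition extend_basis :: "('c \<Rightarrow> 'c \<Rightarrow> 'f) \<Rightarrow> 'c \<Rightarrow> 'c \<Rightarrow> 'f" where
  "extend_basis e c = (if c \<in> C then Lift (e c) else if c \<in> U then delta c else inc K (upper c))"

lemma extend_basis_simps:
  "c \<in> C \<Longrightarrow> extend_basis e c = Lift (e c)"
  "A \<in> U \<Longrightarrow> extend_basis e A = delta A"
  "A \<in> U \<Longrightarrow> extend_basis e (lower A) = inc K A"
  using lower_neq_upper by (auto simp: extend_basis_def critical_iff)

lemma lin_comb_cells:
  "lin_comb (cells K) f \<alpha> x = lin_comb C f \<alpha> x + lin_comb U f \<alpha> x +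
     lin_comb U (\<lambda>A. f (lower A)) (\<lambda>A. \<alpha> (lower A)) x"
proof -
  have cells: "cells K = (C \<union> U) \<union> lower ` U"
    using U_cells lower_cells by (auto simp: critical_iff)
  have disj: "(C \<union> U) \<inter> lower ` U = {}" "C \<inter> U = {}"
    using lower_neq_upper by (auto simp: critical_iff)
  have inj: "inj_on lower U"
    using lower_inj by (auto intro!: inj_onI)
  show ?thesis
    unfolding lin_comb_def
    by (simp add: cells sum.union_disjoint[OF _ _ disj(1)] sum.union_disjoint[OF _ _ disj(2)]
        finite_C finite_U sum.reindex[OF inj])
qed

lemma boundary_delta_upper: "A \<in> U \<Longrightarrow> boundary K (delta A) = inc K A"
  by (rule boundary_delta[OF complex U_cells])

lemma extend_basis_support:
  assumes e: "\<And>c. c \<in> C \<Longrightarrow> e c \<in> fchains N (cdim K c) (filt K c)" and c: "c \<in> cells K"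
  shows "extend_basis e c \<in> fchains K (cdim K c) (filt K c)"
proof -
  consider "c \<in> C" | "c \<in> U" | A where "A \<in> U" "c = lower A"
    using c by (auto simp: critical_iff)
  then show ?thesis
  proof cases
    case 1
    have "Lift (e c) \<in> fchains K (cdim K c) (filt K c)"
    proof (rule lin_comb_in_fchains)
      fix s
      assume s: "s \<in> C" "e c s \<noteq> 0"
      then have "cdim K s = cdim K c" "filt K s \<le> filt K c"
        using e[OF 1] by (auto simp: fchains_def)
      then show "lift s \<in> fchains K (cdim K c) (filt K c)"
        using lift_support[OF s(1)] by (force simp: fchains_def)
    qed
    then show ?thesis
      using 1 by (simp add: extend_basis_simps)
  next
    case 2
    then show ?thesis
      using c by (simp add: extend_basis_simps delta_in_fchains)
  next
    case 3
    \<comment> \<open>By \<open>max_face\<close>, no face of \<open>A\<close> exceeds the value of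
      \<open>lower A\<close>.\<close>
    then show ?thesis
      using incD max_face[OF lower_in_M[OF 3(1)]] incD(3)[OF inc_lower[OF 3(1)]]
      by (auto simp: extend_basis_simps fchains_def)
  qed
qed

text \<open>Split a vanishing combination into a lift, a part \<open>u\<close> on upper cells and
  the boundary of \<open>v\<close>. On lower cells the first two vanish, so triangularity gives
  \<open>v = 0\<close>. Critical coordinates then give \<open>y = 0\<close>, and
  \<open>u = 0\<close> remains.\<close>

lemma extend_basis_independent:
  assumes e: "\<And>c. c \<in> C \<Longrightarrow> e c \<in> fchains N (cdim K c) (filt K c)"
    and ind: "\<And>\<alpha> c. lin_comb C e \<alpha> = (\<lambda>_. 0) \<Longrightarrow> c \<in> C \<Longrightarrow> \<alpha> c = 0"
    and zero: "lin_comb (cells K) (extend_basis e) \<alpha> = (\<lambda>_. 0)" and c: "c \<in> cells K"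
  shows "\<alpha> c = 0"
proof -
  define y where "y = lin_comb C e \<alpha>"
  define u where "u A = (if A \<in> U then \<alpha> A else 0)" for A
  define v where "v A = (if A \<in> U then \<alpha> (lower A) else 0)" for A
  have "lin_comb C (extend_basis e) \<alpha> = lin_comb C (\<lambda>c. Lift (e c)) \<alpha>"
    by (rule lin_comb_cong) (simp add: extend_basis_simps)
  then have 1: "lin_comb C (extend_basis e) \<alpha> = Lift y"
    by (simp add: y_def lin_comb_lin_comb)
  have "lin_comb U (extend_basis e) \<alpha> = lin_comb U delta u"
    unfolding lin_comb_def by (intro ext sum.cong) (simp_all add: extend_basis_simps u_def)
  also have "\<dots> = u"
    by (rule lin_comb_of_deltas[OF finite_U]) (simp add: u_def split: if_splits)
  finally have 2: "lin_comb U (extend_basis e) \<alpha> = u" .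
  have "lin_comb U (\<lambda>A. extend_basis e (lower A)) (\<lambda>A. \<alpha> (lower A)) = lin_comb U (inc K) v"
    unfolding lin_comb_def by (intro ext sum.cong) (simp_all add: extend_basis_simps v_def)
  also have "\<dots> = boundary K v"
    unfolding boundary_lin_comb using U_cells
    by (intro lin_comb_mono_neutral[OF finite_cells]) (auto simp: v_def)
  finally have 3: "lin_comb U (\<lambda>A. extend_basis e (lower A)) (\<lambda>A. \<alpha> (lower A)) = boundary K v" .
  have sum0: "Lift y x + u x + boundary K v x = 0" for x
    using lin_comb_cells[of "extend_basis e" \<alpha> x] zero unfolding 1 2 3 by simp
  have "v = (\<lambda>_. 0)"
  proof (rule zero_if_boundary_zero_on_lower)
    fix A
    assume A: "A \<in> U"
    then have "lower A \<notin> U" "lower A \<notin> C"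
      using lower_neq_upper by (auto simp: critical_iff)
    then show "boundary K v (lower A) = 0"
      using sum0[of "lower A"] by (simp add: Lift_not_upper u_def)
  qed (simp add: v_def split: if_splits)
  then have sum0': "Lift y x + u x = 0" for x
    using sum0[of x] by (simp add: boundary_lin_comb)
  have "y x = 0" for x
  proof (cases "x \<in> C")
    case True
    then show ?thesis
      using sum0'[of x] by (simp add: Lift_not_upper u_def critical_iff)
  next
    case False
    show ?thesis
    proof (rule ccontr)
      assume "y x \<noteq> 0"
      then show False
        unfolding y_def using False e by (elim lin_comb_nonzeroE) (auto simp: fchains_def)
    qed
  qed
  then have y: "y = (\<lambda>_. 0)"
    by blast
  then have "u x = 0" for x
    using sum0'[of x] by simp
  moreover have "\<alpha> s = 0" if "s \<in> C" for s
    using ind y that unfolding y_def by blast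
  moreover have "v x = 0" for x
    using \<open>v = (\<lambda>_. 0)\<close> by simp
  moreover consider "c \<in> C" | "c \<in> U" | A where "A \<in> U" "c = lower A"
    using c by (auto simp: critical_iff)
  ultimately show ?thesis
    unfolding u_def v_def by cases metis+
qed

text \<open>Upper cells are basis elements, and a critical cell is its lift minus upper cells of no
  larger value. A lower cell is obtained by solving the boundary of its partner for it.\<close>

lemma extend_basis_spans:
  assumes e: "\<And>c. c \<in> C \<Longrightarrow> e c \<in> fchains N (cdim K c) (filt K c)"
    and span: "\<And>c. c \<in> C \<Longrightarrow> delta c \<in> lin_comb C e ` fchains N (cdim K c) (filt K c)"
    and c: "c \<in> cells K"
  shows "delta c \<in> lin_comb (cells K) (extend_basis e) ` fchains K (cdim K c) (filt K c)"
proof -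
  let ?S = "\<lambda>d t. lin_comb (cells K) (extend_basis e) ` fchains K d t"
  have mono: "s \<le> t \<Longrightarrow> x \<in> ?S d s \<Longrightarrow> x \<in> ?S d t" for x d s t
    using fchains_mono by blast
  have base: "extend_basis e c \<in> ?S (cdim K c) (filt K c)" if "c \<in> cells K" for c
    using lin_comb_delta[OF finite_cells that, of "extend_basis e"] delta_in_fchains[OF that] by force
  have plus: "(\<lambda>z. x z + y z) \<in> ?S d t" if "x \<in> ?S d t" "y \<in> ?S d t" for x y d t
  proof -
    \<comment> \<open>A sum is a combination indexed by the truth values, with both coefficients
      1.\<close>
    have "lin_comb {True, False} (\<lambda>b. if b then x else y) (\<lambda>_. 1) \<in> ?S d t"
      by (rule lin_comb_in_image) (use that in auto)
    then show ?thesis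
      by (simp add: lin_comb_def)
  qed
  have upper: "delta A \<in> ?S (cdim K A) (filt K A)" if "A \<in> U" for A
    using base[OF U_cells[OF that]] that by (simp add: extend_basis_simps)
  have crit: "delta s \<in> ?S (cdim K s) (filt K s)" if s: "s \<in> C" for s
  proof -
    obtain \<alpha> where \<alpha>: "\<alpha> \<in> fchains N (cdim K s) (filt K s)" "delta s = lin_comb C e \<alpha>"
      using span[OF s] by blast
    have "lift s = Lift (delta s)"
      using lin_comb_delta[OF finite_C s] by metis
    also have "\<dots> = lin_comb C (\<lambda>c. Lift (e c)) \<alpha>"
      by (simp add: \<alpha>(2) lin_comb_lin_comb)
    finally have lift_eq: "lift s = lin_comb C (\<lambda>c. Lift (e c)) \<alpha>" .
    have "lift s \<in> ?S (cdim K s) (filt K s)"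
      unfolding lift_eq
    proof (rule lin_comb_in_image)
      fix c
      assume c: "c \<in> C" "\<alpha> c \<noteq> 0"
      then have "cdim K c = cdim K s" "filt K c \<le> filt K s" "c \<in> cells K"
        using \<alpha>(1) by (auto simp: fchains_def critical_iff)
      then show "Lift (e c) \<in> ?S (cdim K s) (filt K s)"
        using base[of c] mono c(1) by (simp add: extend_basis_simps)
    qed
    note lift_in_S = this
    have upper_part: "lin_comb U delta (\<lambda>A. - lift s A) \<in> ?S (cdim K s) (filt K s)"
    proof (rule lin_comb_in_image)
      fix A
      assume A: "A \<in> U" "- lift s A \<noteq> 0"
      then have "cdim K A = cdim K s" "filt K A \<le> filt K s"
        using lift_support[OF s, of A] by auto
      then show "delta A \<in> ?S (cdim K s) (filt K s)"
        using upper[OF A(1)] mono by simp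
    qed
    have "delta s = (\<lambda>z. lift s z + lin_comb U delta (\<lambda>A. - lift s A) z)"
    proof
      fix z
      have "lin_comb U delta (\<lambda>A. - lift s A) z = (\<Sum>A\<in>U. if A = z then - lift s z else 0)"
        unfolding lin_comb_def delta_def by (intro sum.cong) auto
      then show "delta s z = lift s z + lin_comb U delta (\<lambda>A. - lift s A) z"
        using finite_U s by (auto simp: lift_def delta_def critical_iff)
    qed
    then show ?thesis
      using plus[OF lift_in_S upper_part] by simp
  qed
  \<comment> \<open>The other faces of \<open>A\<close> have at most the value of
    \<open>lower A\<close> by \<open>max_face\<close>. Those that are lower cells have partners
    reachable from \<open>A\<close> in \<open>G\<close>, so the induction follows the converse of
    \<open>G\<close>.\<close>
  have low: "A \<in> U \<Longrightarrow> delta (lower A) \<in> ?S (cdim K (lower A)) (filt K (lower A))" for A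
  proof (induction A rule: wf_induct_rule[OF wf_trancl[OF wf_G_converse]])
    case (1 A)
    let ?a = "lower A"
    let ?d = "cdim K ?a" and ?t = "filt K ?a"
    let ?k = "inc K A ?a"
    have "inc K A \<in> ?S ?d ?t"
      using base[OF lower_cells] 1(2) by (simp add: extend_basis_simps)
    then have x: "lin_comb {A} (inc K) (\<lambda>_. inverse ?k) \<in> ?S ?d ?t"
      by (intro lin_comb_in_image) simp
    have y: "lin_comb (cells K - {?a}) delta (\<lambda>b. - (inverse ?k * inc K A b)) \<in> ?S ?d ?t"
    proof (rule lin_comb_in_image)
      fix b
      assume "b \<in> cells K - {?a}" "- (inverse ?k * inc K A b) \<noteq> 0"
      then have b: "inc K A b \<noteq> 0" "b \<in> cells K" "b \<noteq> ?a"
        by auto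
      have db: "cdim K b = ?d"
        using incD(3)[OF b(1)] incD(3)[OF inc_lower[OF 1(2)]] by simp
      have fb: "filt K b \<le> ?t"
        by (rule max_face[OF lower_in_M[OF 1(2)] b(1)])
      consider "b \<in> C" | "b \<in> U" | B where "B \<in> U" "b = lower B"
        using b(2) by (auto simp: critical_iff)
      then have "delta b \<in> ?S (cdim K b) (filt K b)"
      proof cases
        case 3
        then have "(A, b) \<in> G" "(b, B) \<in> G"
          using G_from_upper[OF 1(2)] b G_up by auto
        then have "(B, A) \<in> (G\<inverse>)\<^sup>+"
          by (meson converse_iff trancl.intros)
        then show ?thesis
          using 1(1) 3 by auto
      qed (use crit upper in auto)
      then show "delta b \<in> ?S ?d ?t"
        using mono fb db by simp
    qed
    have "delta ?a = (\<lambda>z. lin_comb {A} (inc K) (\<lambda>_. inverse ?k) z +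
        lin_comb (cells K - {?a}) delta (\<lambda>b. - (inverse ?k * inc K A b)) z)"
    proof
      fix z
      have "lin_comb (cells K - {?a}) delta (\<lambda>b. - (inverse ?k * inc K A b)) z =
          (\<Sum>b\<in>cells K - {?a}. if b = z then - (inverse ?k * inc K A z) else 0)"
        unfolding lin_comb_def delta_def by (intro sum.cong) auto
      then show "delta ?a z = lin_comb {A} (inc K) (\<lambda>_. inverse ?k) z +
          lin_comb (cells K - {?a}) delta (\<lambda>b. - (inverse ?k * inc K A b)) z"
        using finite_cells incD(2)[of A z] inc_lower[OF 1(2)]
        by (auto simp: lin_comb_def delta_def)
    qed
    then show ?case
      using plus[OF x y] by simp
  qed
  show ?thesis
    using c crit upper low by (cases "c \<in> C"; cases "c \<in> U") (auto simp: critical_iff)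
qed

lemma disjoint_pairs_Un:
  assumes "disjoint_pairs P" "\<And>A b. (A, b) \<in> P \<Longrightarrow> A \<in> C \<and> b \<in> C"
  shows "disjoint_pairs (P \<union> M)"
proof -
  have sep: "{A, b} \<inter> {A', b'} = {}" if "(A, b) \<in> P" "(A', b') \<in> M" for A b A' b'
    using assms(2)[OF that(1)] that(2) unfolding critical_iff M_iff by auto
  have "{A, b} \<inter> {A', b'} = {}"
    if pairs: "(A, b) \<in> P \<union> M" "(A', b') \<in> P \<union> M" "(A, b) \<noteq> (A', b')" for A b A' b'
  proof -
    consider "(A, b) \<in> P" "(A', b') \<in> P" | "(A, b) \<in> P" "(A', b') \<in> M"
      | "(A, b) \<in> M" "(A', b') \<in> P" | "(A, b) \<in> M" "(A', b') \<in> M"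
      using pairs by blast
    then show ?thesis
    proof cases
      case 1
      then show ?thesis
        using disjoint_pairsD[OF assms(1)] pairs(3) by blast
    next
      case 2
      then show ?thesis by (rule sep)
    next
      case 3
      then show ?thesis using sep[of A' b' A b] by blast
    next
      case 4
      then show ?thesis using M_disjoint pairs(3) by blast
    qed
  qed
  then show ?thesis
    unfolding disjoint_pairs_def by blast
qed

text \<open>The boundary clauses for critical cells are carried over by the chain map
  \<open>Lift\<close>. Those for matched pairs hold by construction, as the image of
  \<open>A\<close> is already a boundary.\<close>

theorem decomposition_extend:
  assumes "decomposition N e P"
  shows "decomposition K (extend_basis e) (P \<union> M)"
proof -
  have P: "A \<in> C" "b \<in> C" "cdim K A = Suc (cdim K b)" "filt K b \<le> filt K A"
    "boundary N (e A) = e b" if "(A, b) \<in> P" for A b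
    using assms that unfolding decomposition_def by auto
  have supp: "e c \<in> fchains N (cdim K c) (filt K c)" if "c \<in> C" for c
    using assms that unfolding decomposition_def by auto
  have ind: "\<alpha> c = 0" if "lin_comb C e \<alpha> = (\<lambda>_. 0)" "c \<in> C" for \<alpha> c
    using assms that unfolding decomposition_def by auto
  have span: "delta c \<in> lin_comb C e ` fchains N (cdim K c) (filt K c)" if "c \<in> C" for c
    using assms that unfolding decomposition_def by auto
  have "boundary K (extend_basis e A) = extend_basis e b" if "(A, b) \<in> P \<union> M" for A b
    using that
  proof
    assume "(A, b) \<in> P"
    then show ?thesis
      using P by (simp add: extend_basis_simps boundary_Lift)
  next
    assume "(A, b) \<in> M"
    then show ?thesis
      by (simp add: M_iff extend_basis_simps boundary_delta_upper)
  qed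
  moreover have "boundary K (extend_basis e c) = (\<lambda>_. 0)" if "c \<in> cells K - fst ` (P \<union> M)" for c
  proof -
    consider "c \<in> C" | A where "A \<in> U" "c = lower A"
      using \<open>c \<in> cells K - fst ` (P \<union> M)\<close> by (auto simp: critical_iff image_Un U_def[symmetric])
    then show ?thesis
    proof cases
      case 1
      then have "boundary N (e c) = (\<lambda>_. 0)"
        using assms that unfolding decomposition_def by (auto simp: image_Un)
      then show ?thesis
        using 1 by (simp add: extend_basis_simps boundary_Lift)
    next
      case 2
      then show ?thesis
        using boundary_boundary[OF complex, of "delta A"]
        by (simp add: extend_basis_simps boundary_delta_upper)
    qed
  qed
  moreover have "disjoint_pairs (P \<union> M)"
    using assms P unfolding decomposition_def by (intro disjoint_pairs_Un) auto
  moreover have "A \<in> cells K \<and> b \<in> cells K \<and> cdim K A = Suc (cdim K b) \<and> filt K b \<le> filt K A"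
    if "(A, b) \<in> P \<union> M" for A b
    using that P[of A b] M_D[of A b] incD[of A b] by (auto simp: critical_iff)
  moreover have "\<alpha> c = 0"
    if "lin_comb (cells K) (extend_basis e) \<alpha> = (\<lambda>_. 0)" "c \<in> cells K" for \<alpha> c
    using extend_basis_independent[of e \<alpha> c] supp ind that by blast
  ultimately show ?thesis
    unfolding decomposition_def
    using extend_basis_support[of e, OF supp] extend_basis_spans[of e, OF supp span] by blast
qed

end

section \<open>Dimensions via coordinates\<close>

definition supported :: "'c set \<Rightarrow> ('c \<Rightarrow> 'f::field) set" where
  "supported S = {\<alpha>. \<forall>c. \<alpha> c \<noteq> 0 \<longrightarrow> c \<in> S}"

lemma supported_zero: "(\<lambda>_. 0) \<in> supported S"
  by (simp add: supported_def)

lemma supported_add: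
  assumes "\<alpha> \<in> supported S" "\<beta> \<in> supported S"
  shows "(\<lambda>c. \<alpha> c + \<beta> c) \<in> supported S"
proof -
  have "\<alpha> c = 0" "\<beta> c = 0" if "c \<notin> S" for c
    using that assms by (auto simp: supported_def)
  then show ?thesis
    unfolding supported_def by fastforce
qed

lemma supported_scale: "\<alpha> \<in> supported S \<Longrightarrow> (\<lambda>c. a * \<alpha> c) \<in> supported S"
  by (auto simp: supported_def)

text \<open>\<open>V\<close> is not assumed to be a module: its laws are transported along
  \<open>T\<close> from functions on \<open>S\<close>, and the images of the unit vectors form a
  basis. This fits quotient spaces given as bare records.\<close>

lemma dim_eq_card_coordinates:
  fixes V :: "('f::field, 'v) module" and T :: "('c \<Rightarrow> 'f) \<Rightarrow> 'v"
  assumes finS: "finite S"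
    and inj: "inj_on T (supported S)" and onto: "T ` supported S = carrier V"
    and add: "\<And>\<alpha> \<beta>. \<alpha> \<in> supported S \<Longrightarrow> \<beta> \<in> supported S \<Longrightarrow> T \<alpha> \<oplus>\<^bsub>V\<^esub> T \<beta> = T (\<lambda>c. \<alpha> c + \<beta> c)"
    and smult: "\<And>a \<alpha>. \<alpha> \<in> supported S \<Longrightarrow> a \<odot>\<^bsub>V\<^esub> T \<alpha> = T (\<lambda>c. a * \<alpha> c)"
    and zero: "\<zero>\<^bsub>V\<^esub> = T (\<lambda>_. 0)"
  shows "vectorspace.dim class_ring V = card S"
proof -
  have "module class_ring V"
  proof (rule module_criteria)
    show "cring (class_ring :: 'f ring)"
      by (rule class_cring.cring_axioms)
    show "\<forall>v\<in>carrier V. \<exists>w\<in>carrier V. v \<oplus>\<^bsub>V\<^esub> w = \<zero>\<^bsub>V\<^esub>"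
    proof
      fix v
      assume "v \<in> carrier V"
      then obtain \<alpha> where \<alpha>: "\<alpha> \<in> supported S" "v = T \<alpha>"
        using onto by blast
      then have "T (\<lambda>c. -1 * \<alpha> c) \<in> carrier V"
        using onto supported_scale by blast
      moreover have "v \<oplus>\<^bsub>V\<^esub> T (\<lambda>c. -1 * \<alpha> c) = \<zero>\<^bsub>V\<^esub>"
        unfolding \<alpha>(2) by (subst add[OF \<alpha>(1) supported_scale[OF \<alpha>(1)]]) (simp add: zero)
      ultimately show "\<exists>w\<in>carrier V. v \<oplus>\<^bsub>V\<^esub> w = \<zero>\<^bsub>V\<^esub>"
        by blast
    qed
  qed (auto simp: onto[symmetric] zero add smult supported_zero supported_add supported_scale algebra_simps)
  then interpret vectorspace class_ring V
    by (intro vectorspace.intro) (auto intro: class_field.field_axioms)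
  let ?b = "\<lambda>c. T (delta c)"
  have delta_X: "delta c \<in> supported S" if "c \<in> S" for c
    using that by (simp add: supported_def delta_def)
  have T_carrier: "T \<alpha> \<in> carrier V" if "\<alpha> \<in> supported S" for \<alpha>
    using that onto by blast
  have inj_b: "inj_on ?b S"
  proof (rule inj_onI)
    fix c d
    assume "c \<in> S" "d \<in> S" "?b c = ?b d"
    then have "delta c = (delta d :: 'c \<Rightarrow> 'f)"
      using inj delta_X by (meson inj_onD)
    then have "delta c c = (delta d c :: 'f)"
      by simp
    then show "c = d"
      by (simp add: delta_def split: if_splits)
  qed
  have lincomb: "lincomb a (?b ` B) = T (\<lambda>c. if c \<in> B then a (?b c) else 0)"
    if "finite B" "B \<subseteq> S" for a B
    using that
  proof (induction B)
    case empty
    then show ?case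
      by (simp add: lincomb_def zero)
  next
    case (insert d B)
    have d: "?b d \<notin> ?b ` B"
      using insert inj_b by (auto dest: inj_onD)
    have "lincomb a (?b ` B \<union> {?b d}) = a (?b d) \<odot>\<^bsub>V\<^esub> ?b d \<oplus>\<^bsub>V\<^esub> lincomb a (?b ` B)"
      using insert d delta_X T_carrier by (intro lincomb_insert) auto
    also have "lincomb a (?b ` B) = T (\<lambda>c. if c \<in> B then a (?b c) else 0)"
      using insert by simp
    also have "a (?b d) \<odot>\<^bsub>V\<^esub> ?b d = T (\<lambda>c. a (?b d) * delta d c)"
      using insert delta_X by (intro smult) auto
    also have "T (\<lambda>c. a (?b d) * delta d c) \<oplus>\<^bsub>V\<^esub> T (\<lambda>c. if c \<in> B then a (?b c) else 0) =
        T (\<lambda>c. a (?b d) * delta d c + (if c \<in> B then a (?b c) else 0))"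
      using insert delta_X by (intro add) (auto simp: supported_def delta_def split: if_splits)
    also have "(\<lambda>c. a (?b d) * delta d c + (if c \<in> B then a (?b c) else 0)) =
        (\<lambda>c. if c \<in> insert d B then a (?b c) else 0)"
      using insert by (auto simp: delta_def)
    finally show ?case
      by simp
  qed
  have b_carrier: "?b ` S \<subseteq> carrier V"
    using delta_X T_carrier by auto
  have "lin_indpt (?b ` S)"
  proof (rule finite_lin_indpt2)
    fix a
    assume "lincomb a (?b ` S) = \<zero>\<^bsub>V\<^esub>"
    then have "T (\<lambda>c. if c \<in> S then a (?b c) else 0) = T (\<lambda>_. 0)"
      using lincomb[OF finS] zero by auto
    then have "(\<lambda>c. if c \<in> S then a (?b c) else 0) = (\<lambda>_. 0)"
      by (rule inj_onD[OF inj _ _ supported_zero]) (auto simp: supported_def)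
    then show "\<forall>v\<in>?b ` S. a v = \<zero>\<^bsub>class_ring\<^esub>"
      by (auto dest: fun_cong split: if_splits)
  qed (use finS b_carrier in auto)
  moreover have "gen_set (?b ` S)"
  proof -
    have "carrier V \<subseteq> {lincomb a (?b ` S) |a. a \<in> ?b ` S \<rightarrow> carrier class_ring}"
    proof
      fix v
      assume "v \<in> carrier V"
      then obtain \<alpha> where \<alpha>: "\<alpha> \<in> supported S" "v = T \<alpha>"
        using onto by blast
      \<comment> \<open>\<open>lincomb\<close> takes coefficients indexed by vectors, so \<alpha> is
        pulled back along the injective \<open>?b\<close>.\<close>
      have "(\<lambda>c. if c \<in> S then \<alpha> (inv_into S ?b (?b c)) else 0) = \<alpha>"
        using \<alpha>(1) inv_into_f_f[OF inj_b] by (auto simp: supported_def fun_eq_iff)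
      then have "lincomb (\<lambda>w. \<alpha> (inv_into S ?b w)) (?b ` S) = v"
        using lincomb[OF finS] \<alpha>(2) by simp
      then show "v \<in> {lincomb a (?b ` S) |a. a \<in> ?b ` S \<rightarrow> carrier class_ring}"
        by auto
    qed
    then show ?thesis
      using finite_span[of "?b ` S"] finS b_carrier span_is_subset2[OF b_carrier] by auto
  qed
  ultimately have "dim = card (?b ` S)"
    using finS b_carrier by (intro dim_basis) (auto simp: basis_def)
  then show ?thesis
    by (simp add: card_image[OF inj_b])
qed

section \<open>Persistent homology of a decomposed complex\<close>

lemma chains_sublevel: "chains (sublevel K t) p = fchains K p t"
  by (auto simp: chains_def fchains_def sublevel_def)

lemma boundary_sublevel:
  assumes K: "finite_filtered_chain_complex K" and x: "x \<in> fchains K p t"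
  shows "boundary (sublevel K t) x = boundary K x"
proof
  fix b
  have "boundary K x b = (\<Sum>A\<in>{A \<in> cells K. filt K A \<le> t}. x A * inc K A b)"
    unfolding boundary_def using x fcc_finite[OF K]
    by (intro sum.mono_neutral_right) (auto simp: fchains_def)
  also have "\<dots> = boundary (sublevel K t) x b"
    unfolding boundary_def sublevel_def using fcc_incD[OF K, of _ b]
    by (force intro: sum.cong)
  finally show "boundary (sublevel K t) x b = boundary K x b"
    by simp
qed

section \<open>Cosets of spaces of functions\<close>

definition coset :: "('c \<Rightarrow> 'f::field) set \<Rightarrow> ('c \<Rightarrow> 'f) \<Rightarrow> ('c \<Rightarrow> 'f) set" where
  "coset B x = (\<lambda>b c. b c + x c) ` B"

lemma r_coset_cycle_space: "B +>\<^bsub>cycle_space L p\<^esub> x = coset B x"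
  by (auto simp: a_r_coset_def' coset_def cycle_space_def)

locale function_subspace =
  fixes B :: "('c \<Rightarrow> 'f::field) set"
  assumes zero_closed: "(\<lambda>_. 0) \<in> B"
    and add_closed: "\<And>x y. x \<in> B \<Longrightarrow> y \<in> B \<Longrightarrow> (\<lambda>c. x c + y c) \<in> B"
    and scale_closed: "\<And>a x. x \<in> B \<Longrightarrow> (\<lambda>c. a * x c) \<in> B"
begin

lemma diff_closed: "x \<in> B \<Longrightarrow> y \<in> B \<Longrightarrow> (\<lambda>c. x c - y c) \<in> B"
  using add_closed[of x "\<lambda>c. -1 * y c"] scale_closed[of y "-1"] by simp

lemma coset_mem_iff: "y \<in> coset B x \<longleftrightarrow> (\<lambda>c. y c - x c) \<in> B"
  unfolding coset_def by (auto intro!: image_eqI[of _ _ "\<lambda>c. y c - x c"])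

lemma coset_eq_iff: "coset B x = coset B y \<longleftrightarrow> (\<lambda>c. x c - y c) \<in> B"
proof
  assume eq: "coset B x = coset B y"
  have "x \<in> coset B x"
    by (simp add: coset_mem_iff zero_closed)
  then show "(\<lambda>c. x c - y c) \<in> B"
    by (simp add: eq coset_mem_iff)
next
  assume xy: "(\<lambda>c. x c - y c) \<in> B"
  show "coset B x = coset B y"
  proof (rule Set.set_eqI)
    fix z
    show "z \<in> coset B x \<longleftrightarrow> z \<in> coset B y"
      unfolding coset_mem_iff
      using add_closed[OF _ xy, of "\<lambda>c. z c - x c"] diff_closed[OF _ xy, of "\<lambda>c. z c - y c"]
      by auto
  qed
qed

lemma coset_zero: "coset B (\<lambda>_. 0) = B"
  by (simp add: coset_def)

lemma set_add_coset:
  "set_add (cycle_space L p) (coset B x) (coset B y) = coset B (\<lambda>c. x c + y c)"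
proof (rule Set.set_eqI)
  fix z
  have "z \<in> set_add (cycle_space L p) (coset B x) (coset B y) \<longleftrightarrow>
      (\<exists>b\<in>B. \<exists>b'\<in>B. z = (\<lambda>c. b c + x c + (b' c + y c)))"
    by (auto simp: set_add_def' cycle_space_def coset_def)
  also have "\<dots> \<longleftrightarrow> (\<lambda>c. z c - (x c + y c)) \<in> B"
  proof
    assume "\<exists>b\<in>B. \<exists>b'\<in>B. z = (\<lambda>c. b c + x c + (b' c + y c))"
    then obtain b b' where "b \<in> B" "b' \<in> B" "z = (\<lambda>c. b c + x c + (b' c + y c))"
      by blast
    then show "(\<lambda>c. z c - (x c + y c)) \<in> B"
      using add_closed[of b b'] by (simp add: algebra_simps)
  next
    assume "(\<lambda>c. z c - (x c + y c)) \<in> B"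
    then show "\<exists>b\<in>B. \<exists>b'\<in>B. z = (\<lambda>c. b c + x c + (b' c + y c))"
      using zero_closed by (intro bexI[of _ "\<lambda>c. z c - (x c + y c)"] bexI[of _ "\<lambda>_. 0"]) auto
  qed
  finally show "z \<in> set_add (cycle_space L p) (coset B x) (coset B y) \<longleftrightarrow>
      z \<in> coset B (\<lambda>c. x c + y c)"
    by (simp add: coset_mem_iff)
qed

text \<open>Representatives of a class differ by elements of \<open>B'\<close>, hence of
  \<open>B\<close>, so the union is over equal cosets. The case \<open>a = 1\<close> describes the
  inclusion map on homology, the case \<open>B' = B\<close> scalar multiplication in a
  quotient.\<close>

lemma UN_coset_coset:
  assumes "function_subspace B'" "B' \<subseteq> B"
  shows "(\<Union>y\<in>coset B' x. coset B (\<lambda>c. a * y c)) = coset B (\<lambda>c. a * x c)"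
proof -
  interpret B': function_subspace B' by (rule assms(1))
  have "coset B (\<lambda>c. a * y c) = coset B (\<lambda>c. a * x c)" if "y \<in> coset B' x" for y
  proof -
    have "(\<lambda>c. a * (y c - x c)) \<in> B"
      using that assms(2) by (intro scale_closed) (auto simp: B'.coset_mem_iff)
    then show ?thesis
      by (simp add: coset_eq_iff right_diff_distrib)
  qed
  moreover have "x \<in> coset B' x"
    by (simp add: B'.coset_mem_iff B'.zero_closed)
  ultimately show ?thesis
    by blast
qed

end

section \<open>Sublevel homology in normal-form coordinates\<close>

locale decomposed_complex =
  fixes K :: "('c, 'f::field) filtered_complex" and e :: "'c \<Rightarrow> 'c \<Rightarrow> 'f" and P :: "('c \<times> 'c) set"
  assumes complex: "finite_filtered_chain_complex K" and decomposition: "decomposition K e P"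
begin

abbreviation "E \<equiv> lin_comb (cells K) e"

lemmas finite_cells = fcc_finite[OF complex]

lemma P_D:
  assumes "(A, b) \<in> P"
  shows "A \<in> cells K" "b \<in> cells K" "cdim K A = Suc (cdim K b)" "filt K b \<le> filt K A"
    "boundary K (e A) = e b"
  using decomposition assms unfolding decomposition_def by auto

lemma P_disjoint:
  "(A, b) \<in> P \<Longrightarrow> (A', b') \<in> P \<Longrightarrow> {A, b} \<inter> {A', b'} \<noteq> {} \<Longrightarrow> A = A' \<and> b = b'"
  using decomposition unfolding decomposition_def by (intro disjoint_pairsD[of P]) auto

lemma basis_fchains: "c \<in> cells K \<Longrightarrow> e c \<in> fchains K (cdim K c) (filt K c)"
  and basis_spans: "c \<in> cells K \<Longrightarrow> delta c \<in> E ` fchains K (cdim K c) (filt K c)"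
  using decomposition unfolding decomposition_def by blast+

lemma P_unique:
  assumes "q \<in> P" "q' \<in> P" "fst q = fst q' \<or> snd q = snd q'"
  shows "q = q'"
proof -
  have "{fst q, snd q} \<inter> {fst q', snd q'} \<noteq> {}"
    using assms(3) by auto
  then have "fst q = fst q' \<and> snd q = snd q'"
    using assms(1,2) by (intro P_disjoint) simp_all
  then show ?thesis
    by (simp add: prod_eq_iff)
qed

lemma finite_P: "finite P"
  by (rule finite_subset[of _ "cells K \<times> cells K"]) (use P_D finite_cells in auto)

lemma E_fchains: "E ` fchains K d t = fchains K d t"
proof
  show "E ` fchains K d t \<subseteq> fchains K d t"
  proof
    fix x
    assume "x \<in> E ` fchains K d t"
    then obtain \<alpha> where \<alpha>: "\<alpha> \<in> fchains K d t" "x = E \<alpha>"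
      by blast
    have "E \<alpha> \<in> fchains K d t"
    proof (rule lin_comb_in_fchains)
      fix c
      assume c: "c \<in> cells K" "\<alpha> c \<noteq> 0"
      then have "e c \<in> fchains K (cdim K c) (filt K c)" "cdim K c = d" "filt K c \<le> t"
        using basis_fchains \<alpha>(1) by (auto simp: fchains_def)
      then show "e c \<in> fchains K d t"
        using fchains_mono by blast
    qed
    then show "x \<in> fchains K d t"
      by (simp add: \<alpha>(2))
  qed
next
  show "fchains K d t \<subseteq> E ` fchains K d t"
  proof
    fix x :: "'c \<Rightarrow> 'f"
    assume x: "x \<in> fchains K d t"
    have "lin_comb (cells K) delta x \<in> E ` fchains K d t"
    proof (rule lin_comb_in_image)
      fix c
      assume c: "c \<in> cells K" "x c \<noteq> 0"
      then have "delta c \<in> E ` fchains K (cdim K c) (filt K c)" "cdim K c = d" "filt K c \<le> t"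
        using basis_spans x by (auto simp: fchains_def)
      then show "delta c \<in> E ` fchains K d t"
        using fchains_mono by blast
    qed
    moreover have "lin_comb (cells K) delta x = x"
      using x finite_cells by (intro lin_comb_of_deltas) (auto simp: fchains_def)
    ultimately show "x \<in> E ` fchains K d t"
      by simp
  qed
qed

lemma E_inject:
  assumes "\<And>c. c \<notin> cells K \<Longrightarrow> \<alpha> c = \<beta> c" "E \<alpha> = E \<beta>"
  shows "\<alpha> = \<beta>"
proof
  fix c
  have "E (\<lambda>c. \<alpha> c - \<beta> c) = (\<lambda>_. 0)"
    by (simp add: lin_comb_diff assms(2))
  then have "c \<in> cells K \<Longrightarrow> \<alpha> c - \<beta> c = 0"
    using decomposition unfolding decomposition_def by blast
  then show "\<alpha> c = \<beta> c"
    using assms(1)[of c] by (cases "c \<in> cells K") auto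
qed

definition coface :: "'c \<Rightarrow> 'c" where
  "coface b = (THE A. (A, b) \<in> P)"

lemma coface_eq: "(A, b) \<in> P \<Longrightarrow> coface b = A"
  unfolding coface_def by (rule the_equality) (use P_disjoint in blast)+

text \<open>The boundary in the coordinates of \<open>e\<close>: the coefficient of \<open>A\<close>
  moves to \<open>b\<close> for each pair.\<close>

definition shift :: "('c \<Rightarrow> 'f) \<Rightarrow> 'c \<Rightarrow> 'f" where
  "shift \<alpha> = (\<lambda>b. if b \<in> snd ` P then \<alpha> (coface b) else 0)"

lemma shift_simps:
  "(A, b) \<in> P \<Longrightarrow> shift \<alpha> b = \<alpha> A"
  "b \<notin> snd ` P \<Longrightarrow> shift \<alpha> b = 0"
  by (force simp: shift_def coface_eq)+

lemma boundary_E: "boundary K (E \<alpha>) = E (shift \<alpha>)"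
proof
  fix x
  have inj: "inj_on fst P" "inj_on snd P"
    by (rule inj_onI, rule P_unique, auto)+
  have "boundary K (E \<alpha>) x = (\<Sum>A\<in>cells K. \<alpha> A * boundary K (e A) x)"
    unfolding boundary_lin_comb_commute unfolding lin_comb_def ..
  also have "\<dots> = (\<Sum>A\<in>fst ` P. \<alpha> A * boundary K (e A) x)"
  proof (rule sum.mono_neutral_right)
    show "\<forall>A\<in>cells K - fst ` P. \<alpha> A * boundary K (e A) x = 0"
      using decomposition unfolding decomposition_def by auto
  qed (use finite_cells P_D in auto)
  also have "\<dots> = (\<Sum>q\<in>P. \<alpha> (fst q) * e (snd q) x)"
    unfolding sum.reindex[OF inj(1)] by (rule sum.cong) (auto simp: P_D)
  also have "\<dots> = (\<Sum>q\<in>P. shift \<alpha> (snd q) * e (snd q) x)"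
    by (rule sum.cong) (auto simp: shift_simps)
  also have "\<dots> = (\<Sum>b\<in>snd ` P. shift \<alpha> b * e b x)"
    unfolding sum.reindex[OF inj(2)] by simp
  also have "\<dots> = E (shift \<alpha>) x"
    unfolding lin_comb_def
    by (rule sum.mono_neutral_left) (use finite_cells P_D in \<open>auto simp: shift_simps\<close>)
  finally show "boundary K (E \<alpha>) x = E (shift \<alpha>) x" .
qed

text \<open>Coordinates of the boundaries of the sublevel \<open>t\<close>. Dually,
  \<open>alive p i j\<close> labels a basis of the image of the homology at \<open>i\<close> in that
  at \<open>j\<close>; first components of \<open>P\<close> are excluded there because they do not
  give cycles.\<close>

definition dead :: "nat \<Rightarrow> int \<Rightarrow> ('c \<Rightarrow> 'f) set" where
  "dead p t = supported {c. cdim K c = p \<and> (\<exists>A. (A, c) \<in> P \<and> filt K A \<le> t)}"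

definition alive :: "nat \<Rightarrow> int \<Rightarrow> int \<Rightarrow> 'c set" where
  "alive p i j = {c \<in> cells K. cdim K c = p \<and> filt K c \<le> i \<and> c \<notin> fst ` P \<and>
     (\<forall>A. (A, c) \<in> P \<longrightarrow> j < filt K A)}"

lemma dead_iff:
  "\<beta> \<in> dead p t \<longleftrightarrow> (\<forall>c. \<beta> c \<noteq> 0 \<longrightarrow> cdim K c = p \<and> (\<exists>A. (A, c) \<in> P \<and> filt K A \<le> t))"
  by (simp add: dead_def supported_def)

lemma dead_fchains: "dead p t \<subseteq> fchains K p t"
proof
  fix \<beta>
  assume \<beta>: "\<beta> \<in> dead p t"
  show "\<beta> \<in> fchains K p t"
    unfolding fchains_def
  proof (intro CollectI allI impI)
    fix c
    assume "\<beta> c \<noteq> 0"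
    then obtain A where "cdim K c = p" "(A, c) \<in> P" "filt K A \<le> t"
      using \<beta> by (auto simp: dead_iff)
    then show "c \<in> cells K \<and> cdim K c = p \<and> filt K c \<le> t"
      using P_D(2,4)[of A c] by auto
  qed
qed

lemma boundaries_eq: "boundaries (sublevel K t) p = E ` dead p t"
proof -
  have "boundaries (sublevel K t) p = boundary K ` fchains K (Suc p) t"
    unfolding boundaries_def chains_sublevel using boundary_sublevel[OF complex]
    by (auto intro!: image_cong)
  also have "\<dots> = (\<lambda>\<alpha>. E (shift \<alpha>)) ` fchains K (Suc p) t"
    by (subst E_fchains[symmetric]) (simp add: image_image boundary_E)
  also have "\<dots> = E ` (shift ` fchains K (Suc p) t)"
    by (simp add: image_image)
  also have "shift ` fchains K (Suc p) t = dead p t"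
  proof (intro equalityI subsetI)
    fix \<beta>
    assume "\<beta> \<in> shift ` fchains K (Suc p) t"
    then obtain \<alpha> where \<alpha>: "\<alpha> \<in> fchains K (Suc p) t" "\<beta> = shift \<alpha>"
      by blast
    have "cdim K c = p \<and> (\<exists>A. (A, c) \<in> P \<and> filt K A \<le> t)" if c: "\<beta> c \<noteq> 0" for c
    proof -
      obtain A where A: "(A, c) \<in> P"
        using c shift_simps(2)[of c] unfolding \<alpha>(2) by fastforce
      then have "\<alpha> A \<noteq> 0"
        using c by (simp add: \<alpha>(2) shift_simps)
      then show ?thesis
        using A P_D(3)[OF A] \<alpha>(1) by (auto simp: fchains_def)
    qed
    then show "\<beta> \<in> dead p t"
      by (auto simp: dead_iff)
  next
    fix \<beta>
    assume \<beta>: "\<beta> \<in> dead p t"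
    \<comment> \<open>A preimage under \<open>shift\<close>: the coefficient of \<open>b\<close>
      moves back to its partner.\<close>
    define \<alpha> where "\<alpha> A = (if A \<in> fst ` P then \<beta> (THE b. (A, b) \<in> P) else 0)" for A
    have \<alpha>: "\<alpha> A = \<beta> b" if "(A, b) \<in> P" for A b
    proof -
      have "(THE b. (A, b) \<in> P) = b"
        by (rule the_equality) (use that P_disjoint in blast)+
      then show ?thesis
        using that by (force simp: \<alpha>_def)
    qed
    have "\<alpha> \<in> fchains K (Suc p) t"
      unfolding fchains_def
    proof (intro CollectI allI impI)
      fix A
      assume nz: "\<alpha> A \<noteq> 0"
      then obtain b where b: "(A, b) \<in> P"
        by (auto simp: \<alpha>_def split: if_splits)
      then obtain A' where "cdim K b = p" "(A', b) \<in> P" "filt K A' \<le> t"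
        using nz \<alpha>[OF b] \<beta> by (auto simp: dead_iff)
      moreover from this have "A' = A"
        using P_disjoint[OF b] by blast
      ultimately show "A \<in> cells K \<and> cdim K A = Suc p \<and> filt K A \<le> t"
        using P_D[OF b] by auto
    qed
    moreover have "shift \<alpha> = \<beta>"
    proof
      fix b
      show "shift \<alpha> b = \<beta> b"
      proof (cases "b \<in> snd ` P")
        case True
        then obtain A where A: "(A, b) \<in> P"
          by auto
        then show ?thesis
          by (simp add: shift_simps \<alpha>)
      next
        case False
        then show ?thesis
          using \<beta> by (force simp: shift_simps dead_iff)
      qed
    qed
    ultimately show "\<beta> \<in> shift ` fchains K (Suc p) t"
      by blast
  qed
  finally show ?thesis .
qed

text \<open>Different pairs have different basis elements as boundaries, so no cancellation is
  possible and a cycle has no coefficient on first components of \<open>P\<close>.\<close>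

lemma cycles_eq:
  "carrier (cycle_space (sublevel K t) p) = E ` {\<alpha> \<in> fchains K p t. \<forall>A\<in>fst ` P. \<alpha> A = 0}"
proof -
  have "carrier (cycle_space (sublevel K t) p) = {x \<in> E ` fchains K p t. boundary K x = (\<lambda>_. 0)}"
    unfolding E_fchains cycle_space_def by (auto simp: chains_sublevel boundary_sublevel[OF complex])
  also have "\<dots> = E ` {\<alpha> \<in> fchains K p t. boundary K (E \<alpha>) = (\<lambda>_. 0)}"
    by blast
  also have "{\<alpha> \<in> fchains K p t. boundary K (E \<alpha>) = (\<lambda>_. 0)} =
      {\<alpha> \<in> fchains K p t. \<forall>A\<in>fst ` P. \<alpha> A = 0}"
  proof (rule Collect_cong, rule conj_cong[OF HOL.refl])
    fix \<alpha>
    have "boundary K (E \<alpha>) = (\<lambda>_. 0) \<longleftrightarrow> shift \<alpha> = (\<lambda>_. 0)"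
    proof
      assume "boundary K (E \<alpha>) = (\<lambda>_. 0)"
      then have "E (shift \<alpha>) = E (\<lambda>_. 0)"
        by (simp add: boundary_E)
      then show "shift \<alpha> = (\<lambda>_. 0)"
        by (rule E_inject[rotated]) (auto simp: shift_def dest: P_D(2))
    qed (simp add: boundary_E)
    also have "\<dots> \<longleftrightarrow> (\<forall>A\<in>fst ` P. \<alpha> A = 0)"
    proof
      assume "shift \<alpha> = (\<lambda>_. 0)"
      then have "\<alpha> A = 0" if "(A, b) \<in> P" for A b
        using shift_simps(1)[OF that, of \<alpha>] by simp
      then show "\<forall>A\<in>fst ` P. \<alpha> A = 0"
        by auto
    next
      assume "\<forall>A\<in>fst ` P. \<alpha> A = 0"
      then have "shift \<alpha> b = 0" if "(A, b) \<in> P" for A b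
        using that shift_simps(1)[OF that, of \<alpha>] by force
      then have "shift \<alpha> b = 0" for b
        using shift_simps(2)[of b \<alpha>] by fastforce
      then show "shift \<alpha> = (\<lambda>_. 0)"
        by (rule ext)
    qed
    finally show "boundary K (E \<alpha>) = (\<lambda>_. 0) \<longleftrightarrow> (\<forall>A\<in>fst ` P. \<alpha> A = 0)" .
  qed
  finally show ?thesis .
qed

lemma function_subspace_boundaries: "function_subspace (E ` dead p t)"
proof
  show "(\<lambda>_. 0) \<in> E ` dead p t"
    by (rule image_eqI[of _ _ "\<lambda>_. 0"]) (auto simp: dead_iff)
next
  fix x y
  assume "x \<in> E ` dead p t" "y \<in> E ` dead p t"
  then obtain \<alpha> \<beta> where "\<alpha> \<in> dead p t" "\<beta> \<in> dead p t" and xy: "x = E \<alpha>" "y = E \<beta>"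
    by blast
  then have "(\<lambda>c. \<alpha> c + \<beta> c) \<in> dead p t"
    unfolding dead_def by (intro supported_add)
  then show "(\<lambda>c. x c + y c) \<in> E ` dead p t"
    by (rule image_eqI[rotated]) (simp add: xy lin_comb_add)
next
  fix a x
  assume "x \<in> E ` dead p t"
  then obtain \<alpha> where "\<alpha> \<in> dead p t" and x: "x = E \<alpha>"
    by blast
  then have "(\<lambda>c. a * \<alpha> c) \<in> dead p t"
    by (auto simp: dead_iff)
  then show "(\<lambda>c. a * x c) \<in> E ` dead p t"
    by (rule image_eqI[rotated]) (simp add: x lin_comb_scale)
qed

text \<open>Cycles at \<open>i\<close> and boundaries at \<open>j\<close> are both coordinate
  subspaces. Dropping dead coordinates does not change a class, and a combination of alive elements
  is a boundary only if it is zero, since alive and dead labels are disjoint.\<close>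

theorem persistent_betti_eq:
  assumes "i \<le> j"
  shows "persistent_betti K p i j = card (alive p i j)"
proof -
  let ?Bi = "E ` dead p i" and ?Bj = "E ` dead p j"
  let ?L = "sublevel K j"
  let ?V = "(homology ?L p)
    \<lparr>carrier := inclusion_map ?L p ` carrier (homology (sublevel K i) p)\<rparr>"
  let ?T = "\<lambda>\<alpha>. coset ?Bj (E \<alpha>)"
  let ?X = "supported (alive p i j) :: ('c \<Rightarrow> 'f) set"
  interpret Bi: function_subspace ?Bi by (rule function_subspace_boundaries)
  interpret Bj: function_subspace ?Bj by (rule function_subspace_boundaries)
  have "dead p i \<subseteq> dead p j"
    using assms by (force simp: dead_iff)
  then have Bij: "?Bi \<subseteq> ?Bj"
    by blast
  have "inclusion_map ?L p ` carrier (homology (sublevel K i) p) =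
      (\<lambda>x. inclusion_map ?L p (coset ?Bi x)) ` carrier (cycle_space (sublevel K i) p)"
    unfolding homology_def quotient_space_def
    by (auto simp: A_RCOSETS_def' r_coset_cycle_space boundaries_eq)
  also have "\<dots> = coset ?Bj ` carrier (cycle_space (sublevel K i) p)"
    using Bj.UN_coset_coset[OF function_subspace_boundaries Bij, of 1]
    by (simp add: inclusion_map_def r_coset_cycle_space boundaries_eq)
  also have "\<dots> = ?T ` {\<alpha> \<in> fchains K p i. \<forall>A\<in>fst ` P. \<alpha> A = 0}"
    by (simp add: cycles_eq image_image)
  also have "\<dots> = ?T ` ?X"
  proof (intro equalityI subsetI)
    fix X
    assume "X \<in> ?T ` {\<alpha> \<in> fchains K p i. \<forall>A\<in>fst ` P. \<alpha> A = 0}"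
    then obtain \<alpha> where \<alpha>: "\<alpha> \<in> fchains K p i" "\<forall>A\<in>fst ` P. \<alpha> A = 0" "X = ?T \<alpha>"
      by blast
    \<comment> \<open>The discarded part lies on cells whose partner has value at most
      \<open>j\<close>, as \<alpha> vanishes on first components of \<open>P\<close>; so it is a
      boundary at \<open>j\<close>.\<close>
    define \<alpha>' where "\<alpha>' c = (if c \<in> alive p i j then \<alpha> c else 0)" for c
    have "(\<lambda>c. \<alpha> c - \<alpha>' c) \<in> dead p j"
      unfolding dead_iff
    proof (intro CollectI allI impI)
      fix c
      assume "\<alpha> c - \<alpha>' c \<noteq> 0"
      then have "c \<notin> alive p i j" "\<alpha> c \<noteq> 0"
        by (auto simp: \<alpha>'_def split: if_splits)
      then show "cdim K c = p \<and> (\<exists>A. (A, c) \<in> P \<and> filt K A \<le> j)"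
        using \<alpha>(1,2) by (auto simp: alive_def fchains_def not_less)
    qed
    then have "E (\<lambda>c. \<alpha> c - \<alpha>' c) \<in> ?Bj"
      by blast
    then have "X = ?T \<alpha>'"
      by (simp add: \<alpha>(3) Bj.coset_eq_iff lin_comb_diff)
    then show "X \<in> ?T ` ?X"
      by (auto simp: \<alpha>'_def supported_def)
  qed (auto simp: alive_def fchains_def supported_def)
  finally have carrier: "carrier ?V = ?T ` ?X"
    by simp
  have "finite (alive p i j)"
    using finite_cells by (simp add: alive_def)
  then have "vectorspace.dim class_ring ?V = card (alive p i j)"
  proof (rule dim_eq_card_coordinates[where T = ?T])
    show "inj_on ?T ?X"
    proof (rule inj_onI)
      fix \<alpha> \<beta>
      assume \<alpha>: "\<alpha> \<in> ?X" and \<beta>: "\<beta> \<in> ?X" and "?T \<alpha> = ?T \<beta>"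
      then have "E (\<lambda>c. \<alpha> c - \<beta> c) \<in> ?Bj"
        by (simp add: Bj.coset_eq_iff lin_comb_diff)
      then obtain \<gamma> where \<gamma>: "\<gamma> \<in> dead p j" "E (\<lambda>c. \<alpha> c - \<beta> c) = E \<gamma>"
        by blast
      have "(\<lambda>c. \<alpha> c - \<beta> c) = \<gamma>"
      proof (rule E_inject[OF _ \<gamma>(2)])
        fix c
        assume "c \<notin> cells K"
        then have "\<alpha> c = 0" "\<beta> c = 0" "\<gamma> c = 0"
          using \<alpha> \<beta> subsetD[OF dead_fchains \<gamma>(1)] by (auto simp: alive_def fchains_def supported_def)
        then show "\<alpha> c - \<beta> c = \<gamma> c"
          by simp
      qed
      then have \<gamma>_eq: "\<alpha> c - \<beta> c = \<gamma> c" for c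
        by (rule fun_cong)
      show "\<alpha> = \<beta>"
      proof
        fix c
        show "\<alpha> c = \<beta> c"
        proof (cases "c \<in> alive p i j")
          case True
          then have "\<gamma> c = 0"
            using \<gamma>(1) by (force simp: alive_def dead_iff)
          then show ?thesis
            using \<gamma>_eq[of c] by simp
        next
          case False
          then have "\<alpha> c = 0" "\<beta> c = 0"
            using \<alpha> \<beta> by (auto simp: supported_def)
          then show ?thesis
            by simp
        qed
      qed
    qed
    show "?T ` ?X = carrier ?V"
      by (simp only: carrier)
    show "?T \<alpha> \<oplus>\<^bsub>?V\<^esub> ?T \<beta> = ?T (\<lambda>c. \<alpha> c + \<beta> c)" for \<alpha> \<beta>
      by (simp add: homology_def quotient_space_def Bj.set_add_coset lin_comb_add)
    show "a \<odot>\<^bsub>?V\<^esub> ?T \<alpha> = ?T (\<lambda>c. a * \<alpha> c)" for a \<alpha>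
      using Bj.UN_coset_coset[OF function_subspace_boundaries subset_refl, where x = "E \<alpha>" and a = a]
      by (simp add: homology_def quotient_space_def r_coset_cycle_space boundaries_eq
          lin_comb_scale) (simp add: cycle_space_def)
    show "\<zero>\<^bsub>?V\<^esub> = ?T (\<lambda>_. 0)"
      by (simp add: homology_def quotient_space_def boundaries_eq Bj.coset_zero)
  qed
  then show ?thesis
    by (simp add: persistent_betti_def)
qed

end

section \<open>Barcodes\<close>

lemma count_intervals_of_dim: "count (intervals_of_dim p S) I = count S (p, I)"
  by (induction S) (auto simp: intervals_of_dim_def)

lemma count_image_mset_set:
  "finite X \<Longrightarrow> count (image_mset f (mset_set X)) y = card {x \<in> X. f x = y}"
  by (simp add: count_image_mset Collect_conj_eq Int_commute vimage_def)

text \<open>Pairs of equal value are dropped: their class dies in the sublevel in which it is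
  born.\<close>

definition barcode ::
  "('c, 'f::field) filtered_complex \<Rightarrow> ('c \<times> 'c) set \<Rightarrow> (nat \<times> interval) multiset" where
  "barcode K P = matched_intervals K {(A, b) \<in> P. filt K b < filt K A} +
     image_mset (\<lambda>c. (cdim K c, (filt K c, Pinf)))
       (mset_set {c \<in> cells K. c \<notin> fst ` P \<and> c \<notin> snd ` P})"

context decomposed_complex
begin

definition born :: "nat \<Rightarrow> int \<Rightarrow> int \<Rightarrow> 'c set" where
  "born p i j = {c \<in> alive p i j. filt K c = i}"

lemma finite_alive: "finite (alive p i j)" and finite_born: "finite (born p i j)"
  using finite_cells by (simp_all add: alive_def born_def)

lemma card_alive: "card (alive p i j) = card (alive p (i - 1) j) + card (born p i j)"
proof -
  have "alive p i j = alive p (i - 1) j \<union> born p i j"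
    by (auto simp: alive_def born_def)
  moreover have "alive p (i - 1) j \<inter> born p i j = {}"
    by (auto simp: alive_def born_def)
  ultimately show ?thesis
    using finite_alive finite_born by (simp add: card_Un_disjoint)
qed

text \<open>Values are integers, so a class alive at \<open>d - 1\<close> but not at
  \<open>d\<close> has a partner of value exactly \<open>d\<close>, and \<open>P\<close> contains
  only one pair for it.\<close>

lemma card_born_diff:
  "card (born p a (d - 1)) = card (born p a d) +
     card {q \<in> P. cdim K (snd q) = p \<and> filt K (snd q) = a \<and> filt K (fst q) = d}"
proof -
  let ?Q = "{q \<in> P. cdim K (snd q) = p \<and> filt K (snd q) = a \<and> filt K (fst q) = d}"
  have "born p a (d - 1) = born p a d \<union> snd ` ?Q"
  proof (intro equalityI subsetI)
    fix c
    assume c: "c \<in> born p a (d - 1)"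
    show "c \<in> born p a d \<union> snd ` ?Q"
    proof (cases "\<exists>A. (A, c) \<in> P \<and> filt K A \<le> d")
      case True
      then obtain A where A: "(A, c) \<in> P" "filt K A \<le> d"
        by blast
      then have "filt K A = d"
        using c by (auto simp: born_def alive_def)
      then have "(A, c) \<in> ?Q"
        using A(1) c by (simp add: born_def alive_def)
      then show ?thesis
        by force
    next
      case False
      then show ?thesis
        using c by (auto simp: born_def alive_def not_le)
    qed
  next
    fix c
    assume "c \<in> born p a d \<union> snd ` ?Q"
    then show "c \<in> born p a (d - 1)"
    proof
      assume "c \<in> born p a d"
      then show ?thesis
        by (force simp: born_def alive_def)
    next
      assume "c \<in> snd ` ?Q"
      then obtain A where A: "(A, c) \<in> P" "cdim K c = p" "filt K c = a" "filt K A = d"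
        by auto
      have "d - 1 < filt K A'" if "(A', c) \<in> P" for A'
        using P_disjoint[OF that A(1)] A(4) by simp
      moreover have "c \<notin> fst ` P"
      proof
        assume "c \<in> fst ` P"
        then obtain b where "(c, b) \<in> P"
          by auto
        then have "c = A" "b = c"
          using P_disjoint[OF A(1)] by auto
        then show False
          using P_D(3)[OF A(1)] by simp
      qed
      ultimately show ?thesis
        using A(2,3) P_D(2)[OF A(1)] by (simp add: born_def alive_def)
    qed
  qed
  moreover have "born p a d \<inter> snd ` ?Q = {}"
    by (auto simp: born_def alive_def)
  moreover have "card (snd ` ?Q) = card ?Q"
    by (rule card_image) (auto intro!: inj_onI dest: P_unique)
  ultimately show ?thesis
    using finite_born finite_P by (simp add: card_Un_disjoint)
qed

lemma count_barcode:
  "count (barcode K P) (p, I) =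
     card {q \<in> {(A, b) \<in> P. filt K b < filt K A}.
       (case q of (A, b) \<Rightarrow> (cdim K b, (filt K b, Fin (filt K A)))) = (p, I)} +
     card {c \<in> {c \<in> cells K. c \<notin> fst ` P \<and> c \<notin> snd ` P}. (cdim K c, (filt K c, Pinf)) = (p, I)}"
proof -
  have fin: "finite {(A, b) \<in> P. filt K b < filt K A}"
    "finite {c \<in> cells K. c \<notin> fst ` P \<and> c \<notin> snd ` P}"
    using finite_cells by (auto intro: finite_subset[OF _ finite_P])
  show ?thesis
    unfolding barcode_def matched_intervals_def count_union
      count_image_mset_set[OF fin(1)] count_image_mset_set[OF fin(2)] ..
qed

lemma interval_multiplicity_eq: "interval_multiplicity K p I = int (count (barcode K P) (p, I))"
proof -
  obtain a t where I: "I = (a, t)"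
    by (cases I)
  \<comment> \<open>The condition \<open>i \<le> j\<close> will be \<open>a \<le> d - 1\<close>,
    which is \<open>a < d\<close> over the integers, or \<open>a \<le> ?N\<close>.\<close>
  have betti: "int (persistent_betti K p i j) - int (persistent_betti K p (i - 1) j) =
      int (card (born p i j))" if "i \<le> j" for i j
    using that card_alive[of p i j] by (simp add: persistent_betti_eq)
  show ?thesis
  proof (cases t)
    case (Fin d)
    have rest: "{c \<in> {c \<in> cells K. c \<notin> fst ` P \<and> c \<notin> snd ` P}. (cdim K c, (filt K c, Pinf)) = (p, I)} = {}"
      using I Fin by auto
    have pairs: "{q \<in> {(A, b) \<in> P. filt K b < filt K A}.
        (case q of (A, b) \<Rightarrow> (cdim K b, (filt K b, Fin (filt K A)))) = (p, I)} =
      (if a < d then {q \<in> P. cdim K (snd q) = p \<and> filt K (snd q) = a \<and> filt K (fst q) = d} else {})"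
      using I Fin by auto
    have "count (barcode K P) (p, I) = (if a < d then
        card {q \<in> P. cdim K (snd q) = p \<and> filt K (snd q) = a \<and> filt K (fst q) = d} else 0)"
      unfolding count_barcode rest pairs by simp
    then show ?thesis
      using I Fin betti[of a "d - 1"] betti[of a d] card_born_diff[of p a d]
      by (auto simp: interval_multiplicity_def Let_def)
  next
    case Pinf
    let ?N = "Max (filt K ` cells K)"
    have le_N: "filt K c \<le> ?N" if "c \<in> cells K" for c
      using that finite_cells by simp
    have pairs: "{q \<in> {(A, b) \<in> P. filt K b < filt K A}.
        (case q of (A, b) \<Rightarrow> (cdim K b, (filt K b, Fin (filt K A)))) = (p, I)} = {}"
      using I Pinf by auto
    have rest: "{c \<in> {c \<in> cells K. c \<notin> fst ` P \<and> c \<notin> snd ` P}.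
        (cdim K c, (filt K c, Pinf)) = (p, I)} = (if a \<le> ?N then born p a ?N else {})"
    proof -
      \<comment> \<open>No cell exceeds \<open>?N\<close>, so being alive at \<open>?N\<close> means
        having no partner above at all. For the empty complex, where the maximum is unspecified,
        both sides hold trivially.\<close>
      have "c \<notin> snd ` P \<longleftrightarrow> (\<forall>A. (A, c) \<in> P \<longrightarrow> ?N < filt K A)" for c
        using le_N P_D(1) by (force simp: not_less)
      then show ?thesis
        using I Pinf le_N by (auto simp: born_def alive_def)
    qed
    have "count (barcode K P) (p, I) = (if a \<le> ?N then card (born p a ?N) else 0)"
      unfolding count_barcode rest pairs by simp
    then show ?thesis
      using I Pinf betti[of a ?N] by (auto simp: interval_multiplicity_def Let_def)
  next
    case Minf
    then have "count (barcode K P) (p, I) = 0"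
      unfolding count_barcode using I by (auto simp: card_eq_0_iff)
    then show ?thesis
      using I Minf by (simp add: interval_multiplicity_def Let_def)
  qed
qed

text \<open>The multiplicities are counts of an actual multiset, which settles at once that they are
  nonnegative and almost all zero, and equal counts determine the multiset.\<close>

theorem persistence_intervals_eq: "persistence_intervals K p = intervals_of_dim p (barcode K P)"
  unfolding persistence_intervals_def
proof (rule the_equality)
  show "\<forall>I. int (count (intervals_of_dim p (barcode K P)) I) = interval_multiplicity K p I"
    by (simp add: interval_multiplicity_eq count_intervals_of_dim)
next
  fix D
  assume D: "\<forall>I. int (count D I) = interval_multiplicity K p I"
  show "D = intervals_of_dim p (barcode K P)"
  proof (rule multiset_eqI)
    fix I
    show "count D I = count (intervals_of_dim p (barcode K P)) I"
      using spec[OF D, of I] by (simp add: interval_multiplicity_eq count_intervals_of_dim)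
  qed
qed

end

text \<open>As an existence statement it passes from a Morse complex back to the complex. Still,
  \<open>m\<close> is determined, because it gives the persistence intervals in every
  dimension.\<close>

definition has_barcode ::
  "('c, 'f::field) filtered_complex \<Rightarrow> (nat \<times> interval) multiset \<Rightarrow> bool" where
  "has_barcode K m \<longleftrightarrow> (\<exists>e P. decomposed_complex K e P \<and> barcode K P = m)"

lemma has_barcode_persistence_intervals:
  "has_barcode K m \<Longrightarrow> persistence_intervals K p = intervals_of_dim p m"
  unfolding has_barcode_def using decomposed_complex.persistence_intervals_eq by metis

lemma has_barcode_no_incidence:
  assumes "finite_filtered_chain_complex K" "\<And>A b. inc K A b = 0"
  shows "has_barcode K (remaining_intervals K)"
proof -
  have "barcode K {} = remaining_intervals K"
    by (simp add: barcode_def matched_intervals_def remaining_intervals_def)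
  then show ?thesis
    using decomposition_no_incidence[OF assms] assms(1)
    unfolding has_barcode_def decomposed_complex_def by metis
qed

section \<open>Barcodes under passage to the Morse complex\<close>

context shallow_matching
begin

lemma barcode_Un:
  assumes P: "\<And>A b. (A, b) \<in> P \<Longrightarrow> A \<in> C \<and> b \<in> C"
  shows "barcode K (P \<union> M) = barcode N P + matched_intervals K {(A, b) \<in> M. filt K b < filt K A}"
proof -
  let ?S = "\<lambda>P. {(A, b) \<in> P. filt K b < filt K A}"
  have "P \<subseteq> cells K \<times> cells K" "M \<subseteq> cells K \<times> cells K"
    using P M_D by (auto simp: critical_iff)
  then have fin: "finite (?S P)" "finite (?S M)"
    using finite_cells by (auto intro: finite_subset[of _ "cells K \<times> cells K"])
  have disj: "?S P \<inter> ?S M = {}"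
    using P by (auto simp: critical_iff M_iff)
  have "?S (P \<union> M) = ?S P \<union> ?S M"
    by auto
  then have matched: "matched_intervals K (?S (P \<union> M)) = matched_intervals K (?S P) + matched_intervals K (?S M)"
    unfolding matched_intervals_def by (simp add: mset_set_Union[OF fin disj])
  have "fst ` M = U" "snd ` M = lower ` U"
    using lower_eq by (force simp: U_def)+
  then have rest: "{c \<in> cells K. c \<notin> fst ` (P \<union> M) \<and> c \<notin> snd ` (P \<union> M)} =
      {c \<in> C. c \<notin> fst ` P \<and> c \<notin> snd ` P}"
    by (auto simp: critical_iff image_Un)
  show ?thesis
    unfolding barcode_def matched rest by (simp add: matched_intervals_def)
qed

text \<open>The single step of both reductions: for a compatible matching the added multiset is
  empty, for a matching of the algorithm it is everything collected.\<close>

lemma has_barcode_extend: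
  assumes "has_barcode N m"
  shows "has_barcode K (m + matched_intervals K {(A, b) \<in> M. filt K b < filt K A})"
proof -
  obtain e P where "decomposed_complex N e P" and m: "m = barcode N P"
    using assms by (auto simp: has_barcode_def)
  then interpret N: decomposed_complex N e P
    by simp
  have "decomposed_complex K (extend_basis e) (P \<union> M)"
    using complex decomposition_extend[OF N.decomposition] by (rule decomposed_complex.intro)
  moreover have "barcode K (P \<union> M) = m + matched_intervals K {(A, b) \<in> M. filt K b < filt K A}"
    unfolding m using N.P_D(1,2) by (intro barcode_Un) auto
  ultimately show ?thesis
    unfolding has_barcode_def by blast
qed

lemma card_cells_N:
  assumes "M \<noteq> {}"
  shows "card (cells N) < card (cells K)"
proof (rule psubset_card_mono[OF finite_cells])
  obtain A b where "(A, b) \<in> M"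
    using assms by auto
  then have "A \<in> cells K" "A \<notin> C"
    using M_D by (auto simp: critical_iff M_iff)
  moreover have "C \<subseteq> cells K"
    by (auto simp: critical_iff)
  ultimately show "cells N \<subset> cells K"
    unfolding N_simps(1) by blast
qed

end

section \<open>The iterated Morse complex\<close>

text \<open>Vitality leaves exactly this at a fixed point. It is the state in which the algorithm
  starts.\<close>

definition strictly_filtered :: "('c, 'f::field) filtered_complex \<Rightarrow> bool" where
  "strictly_filtered K \<longleftrightarrow> finite_filtered_chain_complex K \<and>
     (\<forall>A b. inc K A b \<noteq> 0 \<longrightarrow> filt K b < filt K A)"

text \<open>Without pairs only the direct incidence counts as a path. Equality of the records is
  what makes the iteration literally stationary.\<close>

lemma morse_complex_empty:
  assumes "shallow_matching K {}"
  shows "morse_complex K {} = K"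
proof -
  interpret shallow_matching K "{}" by (rule assms)
  have C: "C = cells K" and "U = {}"
    by (auto simp: critical_def U_def)
  moreover have "(s, c) \<in> G \<longleftrightarrow> inc K s c \<noteq> 0" for s c
    using incD[of s c] by (auto simp: morse_graph_def)
  ultimately have path_sum: "path_sum s c = inc K s c" for s c
    using path_sum_step[of s c] by auto
  have "inc N s c = inc K s c" for s c
    using incD(1)[of s c] incD(2)[of s c] by (auto simp: inc_N C path_sum)
  then have "inc N = inc K"
    by blast
  then show ?thesis
    using C N_simps(1) by (cases K) (simp add: morse_complex_def)
qed

lemma compatible_shallow:
  assumes "finite_filtered_chain_complex K" "acyclic_matching K M" "compatible K M"
  shows "shallow_matching K M"
proof
  fix A b c
  assume "(A, b) \<in> M"
  then have eq: "filt K A = filt K b"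
    using assms(3) by (auto simp: compatible_def)
  show "filt K c \<le> filt K b" if "inc K A c \<noteq> 0"
    using fcc_incD(4)[OF assms(1) that] eq by simp
  show "filt K A \<le> filt K c" if "inc K c b \<noteq> 0"
    using fcc_incD(4)[OF assms(1) that] eq by simp
qed (use assms in auto)

lemma vital_step:
  assumes K: "finite_filtered_chain_complex K" and MM: "vital_filtered_morse_construction MM"
  shows "finite_filtered_chain_complex (MM K)" "has_barcode (MM K) m \<Longrightarrow> has_barcode K m"
    "MM K = K \<and> strictly_filtered K \<or> card (cells (MM K)) < card (cells K)"
proof -
  obtain M where M: "acyclic_matching K M" "compatible K M" "MM K = morse_complex K M"
    and vital: "(\<exists>A\<in>cells K. \<exists>b\<in>cells K. inc K A b \<noteq> 0 \<and> filt K A = filt K b) \<longrightarrow> M \<noteq> {}"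
    using MM K unfolding vital_filtered_morse_construction_def by blast
  interpret shallow_matching K M
    by (rule compatible_shallow[OF K M(1,2)])
  show "finite_filtered_chain_complex (MM K)"
    unfolding M(3) by (rule N_complex)
  have empty: "{(A, b) \<in> M. filt K b < filt K A} = {}"
    using M(2) by (auto simp: compatible_def)
  have "matched_intervals K {(A, b) \<in> M. filt K b < filt K A} = {#}"
    unfolding empty by (simp add: matched_intervals_def)
  then show "has_barcode K m" if "has_barcode (MM K) m"
    using has_barcode_extend[of m] that unfolding M(3) by simp
  show "MM K = K \<and> strictly_filtered K \<or> card (cells (MM K)) < card (cells K)"
  proof (cases "M = {}")
    case True
    have "filt K b < filt K A" if "inc K A b \<noteq> 0" for A b
      using vital True that incD[OF that] by force
    then have "strictly_filtered K"
      using K by (simp add: strictly_filtered_def)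
    moreover have "MM K = K"
      using M(3) True morse_complex_empty shallow_matching_axioms by metis
    ultimately show ?thesis
      by blast
  next
    case False
    then show ?thesis
      unfolding M(3) using card_cells_N by blast
  qed
qed

lemma funpow_stable:
  assumes "MM L = L"
  shows "(MM ^^ k) L = L"
  using assms by (induction k) auto

lemma vital_stabilizes:
  assumes "finite_filtered_chain_complex K" and MM: "vital_filtered_morse_construction MM"
  shows "\<exists>n L. (MM ^^ n) K = L \<and> MM L = L \<and> strictly_filtered L \<and>
    (\<forall>m. has_barcode L m \<longrightarrow> has_barcode K m)"
  using assms(1)
proof (induction "card (cells K)" arbitrary: K rule: less_induct)
  case less
  note step = vital_step[OF less(2) MM]
  show ?case
  proof (cases "card (cells (MM K)) < card (cells K)")
    case True
    then obtain n L where "(MM ^^ n) (MM K) = L" "MM L = L" "strictly_filtered L"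
      "\<forall>m. has_barcode L m \<longrightarrow> has_barcode (MM K) m"
      using less(1) step(1) by blast
    then have "(MM ^^ Suc n) K = L \<and> MM L = L \<and> strictly_filtered L \<and>
        (\<forall>m. has_barcode L m \<longrightarrow> has_barcode K m)"
      using step(2) by (simp only: funpow_Suc_right o_apply) blast
    then show ?thesis
      by blast
  next
    case False
    then have "MM K = K" "strictly_filtered K"
      using step(3) by auto
    then show ?thesis
      by (intro exI[of _ 0] exI[of _ K]) simp
  qed
qed

lemma iterated_morse_complex:
  assumes "finite_filtered_chain_complex K" "vital_filtered_morse_construction MM"
  shows "strictly_filtered (iterated_morse_complex MM K)"
    "has_barcode (iterated_morse_complex MM K) m \<Longrightarrow> has_barcode K m"
proof -
  obtain n L where L: "(MM ^^ n) K = L" "MM L = L" "strictly_filtered L"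
    "\<forall>m. has_barcode L m \<longrightarrow> has_barcode K m"
    using vital_stabilizes[OF assms] by blast
  have stable: "(MM ^^ m) K = L" if "m \<ge> n" for m
  proof -
    have "(MM ^^ m) K = (MM ^^ (m - n)) ((MM ^^ n) K)"
      using that by (metis comp_apply funpow_add le_add_diff_inverse2)
    then show ?thesis
      using L(1,2) by (simp add: funpow_stable)
  qed
  have "iterated_morse_complex MM K = L"
    unfolding iterated_morse_complex_def
  proof (rule the_equality)
    show "\<exists>n. \<forall>m\<ge>n. (MM ^^ m) K = L"
      using stable by blast
  next
    fix L'
    assume "\<exists>n. \<forall>m\<ge>n. (MM ^^ m) K = L'"
    then obtain n' where "\<forall>m\<ge>n'. (MM ^^ m) K = L'"
      by blast
    then show "L' = L"
      using stable[of "max n n'"] by simp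
  qed
  then show "strictly_filtered (iterated_morse_complex MM K)"
    "has_barcode (iterated_morse_complex MM K) m \<Longrightarrow> has_barcode K m"
    using L by auto
qed

section \<open>The interval algorithm\<close>

text \<open>\<open>ls\<close> lists the values still to be processed, including the current one.
  Nonzero boundaries occur only at those values, which yields \<open>min_coface\<close> at the
  smallest of them.\<close>

definition algorithm_invariant :: "int list \<Rightarrow> ('c, 'f::field) filtered_complex \<Rightarrow> bool" where
  "algorithm_invariant ls K \<longleftrightarrow> strictly_filtered K \<and> sorted_wrt (<) ls \<and>
     (\<forall>A b. inc K A b \<noteq> 0 \<longrightarrow> filt K A \<in> set ls)"

lemma admissible_step:
  assumes inv: "algorithm_invariant (i # ls) K" and M: "admissible_choice K i M"
  shows "shallow_matching K M" "algorithm_invariant (i # ls) (morse_complex K M)"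
    "has_barcode (morse_complex K M) m \<Longrightarrow> has_barcode K (m + matched_intervals K M)"
proof -
  have strict: "strictly_filtered K" and sorted: "sorted_wrt (<) (i # ls)"
    and levels: "\<And>A b. inc K A b \<noteq> 0 \<Longrightarrow> filt K A \<in> set (i # ls)"
    using inv unfolding algorithm_invariant_def by blast+
  have ge_i: "i \<le> filt K A" if "inc K A b \<noteq> 0" for A b
    using levels[OF that] sorted by auto
  have inc_M: "inc K A b \<noteq> 0" "filt K A \<le> i" "\<And>c. inc K A c \<noteq> 0 \<Longrightarrow> filt K c \<le> filt K b"
    if "(A, b) \<in> M" for A b
    using M that unfolding admissible_choice_def acyclic_matching_def matching_def face_def by auto
  show shallow: "shallow_matching K M"
  proof
    fix A b c
    assume AbM: "(A, b) \<in> M"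
    show "filt K c \<le> filt K b" if "inc K A c \<noteq> 0"
      using inc_M(3)[OF AbM that] .
    show "filt K A \<le> filt K c" if "inc K c b \<noteq> 0"
      using inc_M(2)[OF AbM] ge_i[OF that] by simp
  qed (use strict M in \<open>auto simp: strictly_filtered_def admissible_choice_def\<close>)
  then interpret shallow_matching K M .
  show "algorithm_invariant (i # ls) (morse_complex K M)"
    unfolding algorithm_invariant_def strictly_filtered_def
  proof (intro conjI allI impI)
    fix s c
    assume sc: "inc N s c \<noteq> 0"
    show "filt N c < filt N s"
      using N_strict[OF _ sc] strict unfolding strictly_filtered_def by blast
    \<comment> \<open>A cell with a face in the Morse complex had a face before, so no finished
      value acquires incidences again.\<close>
    show "filt N s \<in> set (i # ls)"
      using inc_N_D(4)[OF sc] levels by auto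
  qed (use N_complex sorted in auto)
  \<comment> \<open>By strictness every matched pair has a bar of positive length, so
    \<open>barcode\<close> keeps all that the algorithm collects.\<close>
  have "{(A, b) \<in> M. filt K b < filt K A} = M"
    using strict inc_M(1) unfolding strictly_filtered_def by auto
  then show "has_barcode K (m + matched_intervals K M)" if "has_barcode (morse_complex K M) m"
    using has_barcode_extend[OF that] by simp
qed

text \<open>The intervals collected enter as an increment \<open>T\<close>: increments of successive
  levels add up while the barcode is carried from the final complex back to the initial one.\<close>

lemma process_level_correct:
  assumes "process_level i X Y" "algorithm_invariant (i # ls) (fst X)"
  shows "algorithm_invariant ls (fst Y) \<and>
    (\<exists>T. snd Y = snd X + T \<and> (\<forall>m. has_barcode (fst Y) m \<longrightarrow> has_barcode (fst X) (m + T)))"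
  using assms
proof (induction rule: process_level.induct)
  case (finish K S)
  have "filt K A \<in> set ls" if "inc K A b \<noteq> 0" for A b
  proof -
    have "filt K b < filt K A" "filt K A \<in> set (i # ls)" "A \<in> cells K" "b \<in> cells K"
      using finish(2) that fcc_incD[of K A b]
      unfolding algorithm_invariant_def strictly_filtered_def by auto
    \<comment> \<open>A level ends when no incidence is left among cells of value at most
      \<open>i\<close>. Faces have smaller value, so a cell of value \<open>i\<close> then has no
      face at all.\<close>
    moreover have "\<not> (filt K A \<le> i \<and> filt K b \<le> i)"
      using finish(1) that \<open>A \<in> cells K\<close> \<open>b \<in> cells K\<close> unfolding admissible_choice_def by blast
    ultimately show ?thesis
      by auto
  qed
  then have "algorithm_invariant ls K"
    using finish(2) unfolding algorithm_invariant_def by simp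
  then show ?case
    by (intro conjI exI[of _ "{#}"]) simp_all
next
  case (continue K M S Y)
  have inv: "algorithm_invariant (i # ls) K"
    using continue.prems by simp
  note step = admissible_step[OF inv continue.hyps(1)]
  obtain T where "algorithm_invariant ls (fst Y)" "snd Y = S + matched_intervals K M + T"
    and T: "\<And>m. has_barcode (fst Y) m \<Longrightarrow> has_barcode (morse_complex K M) (m + T)"
    using continue.IH step(2) by auto
  moreover have "has_barcode K (m + (matched_intervals K M + T))" if "has_barcode (fst Y) m" for m
    using step(3)[OF T[OF that]] by (simp add: ac_simps)
  ultimately show ?case
    by (intro conjI exI[of _ "matched_intervals K M + T"]) (simp_all add: ac_simps)
qed

lemma process_levels_correct:
  assumes "process_levels ls X Y" "algorithm_invariant ls (fst X)"
  shows "algorithm_invariant [] (fst Y) \<and>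
    (\<exists>T. snd Y = snd X + T \<and> (\<forall>m. has_barcode (fst Y) m \<longrightarrow> has_barcode (fst X) (m + T)))"
  using assms
proof (induction rule: process_levels.induct)
  case (Nil X)
  then show ?case
    by (intro conjI exI[of _ "{#}"]) simp_all
next
  case (Cons i X X' ls X'')
  from process_level_correct[OF Cons.hyps(1) Cons.prems]
  obtain T where inv: "algorithm_invariant ls (fst X')" and T: "snd X' = snd X + T"
    "\<And>m. has_barcode (fst X') m \<Longrightarrow> has_barcode (fst X) (m + T)"
    by blast
  from Cons.IH[OF inv]
  obtain T' where inv': "algorithm_invariant [] (fst X'')" and T': "snd X'' = snd X' + T'"
    "\<And>m. has_barcode (fst X'') m \<Longrightarrow> has_barcode (fst X') (m + T')"
    by blast
  have "has_barcode (fst X) (m + (T + T'))" if "has_barcode (fst X'') m" for m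
    using T(2)[OF T'(2)[OF that]] by (simp add: ac_simps)
  then show ?case
    using inv' T(1) T'(1) by (intro conjI exI[of _ "T + T'"]) (simp_all add: ac_simps)
qed

section \<open>Existence of runs of the algorithm\<close>

lemma acyclic_by_rank:
  fixes r :: "'a \<Rightarrow> nat"
  assumes "\<And>a b. (a, b) \<in> R \<Longrightarrow> r b < r a"
  shows "acyclic R"
proof -
  have "r b < r a" if "(a, b) \<in> R\<^sup>+" for a b
    using that by (induction rule: trancl.induct) (auto dest!: assms)
  then show ?thesis
    unfolding acyclic_def by blast
qed

lemma acyclic_matching_empty:
  assumes "finite_filtered_chain_complex K"
  shows "acyclic_matching K {}"
proof -
  have "acyclic (morse_graph K {})"
    by (rule acyclic_by_rank[where r = "cdim K"]) (auto simp: morse_graph_def dest: fcc_incD[OF assms])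
  then show ?thesis
    by (simp add: acyclic_matching_def matching_def)
qed

text \<open>
  Thrice the dimension is a rank decreasing along the Morse graph, except that the reversed edge
  forces \<open>A\<close> and \<open>b\<close> in between: below the other cofaces of \<open>b\<close> and above the other faces of \<open>A\<close>.
\<close>

lemma acyclic_matching_singleton:
  assumes K: "finite_filtered_chain_complex K" and Ab: "inc K A b \<noteq> 0"
  shows "acyclic_matching K {(A, b)}"
proof -
  define r where "r c = (if c = b then 3 * cdim K b + 2 else if c = A then 3 * cdim K b + 1
    else 3 * cdim K c)" for c
  have dim: "cdim K A = Suc (cdim K b)"
    by (rule fcc_incD(3)[OF K Ab])
  have "acyclic (morse_graph K {(A, b)})"
  proof (rule acyclic_by_rank[where r = r])
    fix x y
    assume "(x, y) \<in> morse_graph K {(A, b)}"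
    then consider "inc K x y \<noteq> 0" "(x, y) \<noteq> (A, b)" | "x = b" "y = A"
      unfolding morse_graph_def by auto
    then show "r y < r x"
    proof cases
      case 1
      have "cdim K x = Suc (cdim K y)"
        by (rule fcc_incD(3)[OF K 1(1)])
      then show ?thesis
        using 1(2) dim by (auto simp: r_def)
    next
      case 2
      then show ?thesis
        using dim by (auto simp: r_def)
    qed
  qed
  moreover have "matching K {(A, b)}"
    using Ab fcc_incD[OF K Ab] by (simp add: matching_def)
  ultimately show ?thesis
    by (simp add: acyclic_matching_def)
qed

text \<open>One pair suffices: a cell with a face, matched with a face of maximal value, which
  monotonicity keeps at most \<open>i\<close>.\<close>

lemma admissible_choice_exists:
  assumes K: "finite_filtered_chain_complex K"
  obtains M where "admissible_choice K i M"
proof (cases "\<exists>A\<in>cells K. \<exists>b\<in>cells K. filt K A \<le> i \<and> filt K b \<le> i \<and> inc K A b \<noteq> 0")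
  case True
  then obtain A c where A: "filt K A \<le> i" "inc K A c \<noteq> 0"
    by blast
  let ?F = "{b. inc K A b \<noteq> 0}"
  have "?F \<subseteq> cells K"
    using fcc_incD(2)[OF K] by blast
  then have fin: "finite (filt K ` ?F)"
    using fcc_finite[OF K] finite_subset by blast
  then have "Max (filt K ` ?F) \<in> filt K ` ?F"
    using A(2) by (intro Max_in) auto
  then obtain b where b: "inc K A b \<noteq> 0" "filt K b = Max (filt K ` ?F)"
    by auto
  have "filt K b' \<le> filt K b" if "inc K A b' \<noteq> 0" for b'
    unfolding b(2) using fin that by (intro Max_ge) auto
  moreover have "filt K b \<le> i"
    using fcc_incD(4)[OF K b(1)] A(1) by simp
  ultimately have "admissible_choice K i {(A, b)}"
    using acyclic_matching_singleton[OF K b(1)] A(1) by (simp add: admissible_choice_def face_def)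
  then show ?thesis
    by (rule that)
next
  case False
  then have "admissible_choice K i {}"
    using acyclic_matching_empty[OF K] by (simp add: admissible_choice_def)
  then show ?thesis
    by (rule that)
qed

lemma process_level_exists:
  assumes "algorithm_invariant (i # ls) K"
  shows "\<exists>Y. process_level i (K, S) Y"
  using assms
proof (induction "card (cells K)" arbitrary: K S rule: less_induct)
  case less
  have "finite_filtered_chain_complex K"
    using less.prems by (simp add: algorithm_invariant_def strictly_filtered_def)
  then obtain M where M: "admissible_choice K i M"
    by (rule admissible_choice_exists)
  show ?case
  proof (cases "M = {}")
    case True
    then show ?thesis
      using M process_level.finish by blast
  next
    case False
    note step = admissible_step[OF less.prems M]
    have "card (cells (morse_complex K M)) < card (cells K)"
      by (rule shallow_matching.card_cells_N[OF step(1) False])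
    from less.hyps[OF this step(2)]
    obtain Y where "process_level i (morse_complex K M, S + matched_intervals K M) Y"
      by blast
    then show ?thesis
      using process_level.continue[OF M False] by blast
  qed
qed

lemma process_levels_exists:
  assumes "algorithm_invariant ls (fst X)"
  shows "\<exists>Y. process_levels ls X Y"
  using assms
proof (induction ls arbitrary: X)
  case Nil
  then show ?case
    using process_levels.Nil by blast
next
  case (Cons i ls)
  obtain Y where Y: "process_level i X Y"
    using process_level_exists[OF Cons.prems, of "snd X"] by auto
  then obtain Z where "process_levels ls Y Z"
    using Cons.IH process_level_correct[OF Y Cons.prems] by blast
  then show ?case
    using process_levels.Cons[OF Y] by blast
qed

text \<open>Starting at the second smallest value is enough: faces have strictly smaller value, so a
  cell of the smallest value has none.\<close>

lemma algorithm_invariant_start: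
  assumes "strictly_filtered K"
  shows "algorithm_invariant (tl (sorted_list_of_set (filt K ` cells K))) K"
proof -
  let ?l = "sorted_list_of_set (filt K ` cells K)"
  have K: "finite_filtered_chain_complex K"
    using assms by (simp add: strictly_filtered_def)
  have set: "set ?l = filt K ` cells K"
    using fcc_finite[OF K] by simp
  have sorted: "sorted_wrt (<) ?l"
    by (rule strict_sorted_list_of_set)
  have "filt K A \<in> set (tl ?l)" if "inc K A b \<noteq> 0" for A b
  proof -
    have "filt K A \<in> set ?l" "filt K b \<in> set ?l" "filt K b < filt K A"
      using that fcc_incD[OF K that] assms unfolding set strictly_filtered_def by auto
    then show ?thesis
      using sorted by (cases ?l) auto
  qed
  moreover have "sorted_wrt (<) (tl ?l)"
    using sorted by (cases ?l) auto
  ultimately show ?thesis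
    using assms by (simp add: algorithm_invariant_def)
qed

lemma interval_algorithm_correct:
  assumes "strictly_filtered K" "interval_algorithm K out"
  shows "has_barcode K out"
proof -
  obtain K' S where run: "process_levels (tl (sorted_list_of_set (filt K ` cells K))) (K, {#}) (K', S)"
    and out: "out = S + remaining_intervals K'"
    using assms(2) by (auto simp: interval_algorithm_def)
  have inv: "algorithm_invariant [] K'" and transfer: "\<And>m. has_barcode K' m \<Longrightarrow> has_barcode K (m + S)"
    using process_levels_correct[OF run] algorithm_invariant_start[OF assms(1)] by auto
  \<comment> \<open>The invariant for the empty list leaves no incidence, so every remaining cell is
    an unpaired basis element.\<close>
  have "has_barcode K' (remaining_intervals K')"
    using inv unfolding algorithm_invariant_def strictly_filtered_def
    by (intro has_barcode_no_incidence) auto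
  from transfer[OF this] show ?thesis
    by (simp add: out ac_simps)
qed

lemma interval_algorithm_terminates:
  assumes "strictly_filtered K"
  shows "\<exists>out. interval_algorithm K out"
proof -
  have "\<exists>Y. process_levels (tl (sorted_list_of_set (filt K ` cells K))) (K, {#}) Y"
    by (rule process_levels_exists) (simp add: algorithm_invariant_start[OF assms])
  then obtain Y where "process_levels (tl (sorted_list_of_set (filt K ` cells K))) (K, {#}) Y"
    by blast
  then show ?thesis
    unfolding interval_algorithm_def by (cases Y) blast
qed

theorem theorem8p1:
  fixes K :: "('c, 'f::field) filtered_complex"
    and MM :: "('c, 'f) filtered_complex \<Rightarrow> ('c, 'f) filtered_complex"
  assumes "finite_filtered_chain_complex K"
    and "vital_filtered_morse_construction MM"
  shows "(\<exists>out. interval_algorithm (iterated_morse_complex MM K) out) \<and>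
         (\<forall>out. interval_algorithm (iterated_morse_complex MM K) out \<longrightarrow>
            (\<forall>p. persistence_intervals K p = intervals_of_dim p out))"
proof -
  note iterated = iterated_morse_complex[OF assms]
  have "persistence_intervals K p = intervals_of_dim p out"
    if "interval_algorithm (iterated_morse_complex MM K) out" for out p
    using interval_algorithm_correct[OF iterated(1) that]
    by (intro has_barcode_persistence_intervals iterated(2))
  then show ?thesis
    using interval_algorithm_terminates[OF iterated(1)] by blast
qed

end
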